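(* The constant $\delta=\inf\{d\in\mathbb{R} : (d,1]\subset\mathbb{D}\}$ satisfies $$\delta\le \frac{111\,(397+\sqrt{26565})}{65522}\ (\approx 0.94866).$$
   Context: For real $x$ let $\|x\|=\min\{\{x\},1-\{x\}\}$ be the distance from $x$ to the nearest integer. For real $\alpha$ and $t\ge 1$ let $\psi_\alpha(t)=\min_{1\le q\le t}\|q\alpha\|$, the minimum being over integers $q$, and let $d(\alpha)=\limsup_{t\to\infty}t\,\psi_\alpha(t)$ (the Dirichlet constant). The Dirichlet spectrum is $\mathbb{D}=\{d(\alpha):\alpha\in\mathbb{R}\}$; one has $\mathbb{D}\subset[0,1]$. *)

theory Defs
  imports "HOL-Analysis.Analysis" "HOL-Real_Asymp.Real_Asymp"
begin

definition dist_int :: "real \<Rightarrow> real" where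
  "dist_int x = min (frac x) (1 - frac x)"

text \<open>The minimum is over a finite nonempty set for \<open>t \<ge> 1\<close>; the value for \<open>t < 1\<close> is
  irrelevant, since only \<open>t \<rightarrow> \<infinity>\<close> is ever considered.\<close>

definition dirichlet_psi :: "real \<Rightarrow> real \<Rightarrow> real" where
  "dirichlet_psi \<alpha> t =
     Min ((\<lambda>q. dist_int (of_int q * \<alpha>)) ` {q::int. 1 \<le> q \<and> of_int q \<le> t})"

text \<open>The upper limit is formed in the extended reals, where it always exists; it is finite by
  \<open>dirichlet_const_bounds\<close> below.\<close>

definition dirichlet_const :: "real \<Rightarrow> ereal" where
  "dirichlet_const \<alpha> = Limsup at_top (\<lambda>t::real. ereal (t * dirichlet_psi \<alpha> t))"

definition dirichlet_spectrum :: "real set" where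
  "dirichlet_spectrum = {d. \<exists>\<alpha>. dirichlet_const \<alpha> = ereal d}"

lemma finite_int_range: "finite {q::int. 1 \<le> q \<and> of_int q \<le> (t::real)}"
  by (rule finite_subset[of _ "{1..\<lfloor>t\<rfloor>}"]) (auto simp: le_floor_iff)

lemma dist_int_nonneg: "0 \<le> dist_int x"
  by (simp add: dist_int_def less_imp_le[OF frac_lt_1])

lemma dist_int_le: "dist_int x \<le> \<bar>x - of_int m\<bar>"
proof (cases "m \<le> \<lfloor>x\<rfloor>")
  case True
  then have "real_of_int m \<le> of_int \<lfloor>x\<rfloor>" by simp
  then show ?thesis unfolding dist_int_def frac_def by linarith
next
  case False
  then have "real_of_int \<lfloor>x\<rfloor> + 1 \<le> of_int m" by linarith
  then show ?thesis unfolding dist_int_def frac_def by linarith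
qed

lemma dirichlet_psi_nonneg:
  assumes "1 \<le> t"
  shows "0 \<le> dirichlet_psi \<alpha> t"
proof -
  let ?B = "(\<lambda>q. dist_int (of_int q * \<alpha>)) ` {q::int. 1 \<le> q \<and> of_int q \<le> t}"
  have "finite ?B" using finite_int_range by blast
  moreover have "?B \<noteq> {}" using assms by (auto intro: exI[of _ "1::int"])
  ultimately have "Min ?B \<in> ?B" by (rule Min_in)
  then show ?thesis
    unfolding dirichlet_psi_def using dist_int_nonneg by auto
qed

lemma dirichlet_psi_upper:
  assumes "2 \<le> t"
  shows "t * dirichlet_psi \<alpha> t \<le> t / (t - 1)"
proof -
  define N where "N = nat \<lfloor>t\<rfloor>"
  have N: "N > 0" "real N \<le> t" "t - 1 < real N" using assms unfolding N_def by linarith+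
  obtain h k where hk: "0 < k" "k \<le> int N" "\<bar>of_int k * \<alpha> - of_int h\<bar> < 1 / N"
    using Dirichlet_approx[OF N(1), of \<alpha>] by blast
  have "real_of_int k \<le> t" using hk(2) N(2) by linarith
  then have "dirichlet_psi \<alpha> t \<le> dist_int (of_int k * \<alpha>)"
    unfolding dirichlet_psi_def using hk(1) finite_int_range
    by (intro Min_le) auto
  also have "\<dots> \<le> 1 / N" using dist_int_le[of "of_int k * \<alpha>" h] hk(3) by linarith
  also have "\<dots> \<le> 1 / (t - 1)" using N assms by (intro divide_left_mono) auto
  finally have "t * dirichlet_psi \<alpha> t \<le> t * (1 / (t - 1))"
    using assms by (intro mult_left_mono) auto
  then show ?thesis by simp
qed

lemma dirichlet_const_bounds: "0 \<le> dirichlet_const \<alpha>" "dirichlet_const \<alpha> \<le> 1"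
proof -
  have "eventually (\<lambda>t::real. (0::ereal) \<le> ereal (t * dirichlet_psi \<alpha> t)) at_top"
    using eventually_ge_at_top[of "1::real"]
    by eventually_elim (simp add: dirichlet_psi_nonneg)
  then have "Liminf at_top (\<lambda>t::real. ereal (t * dirichlet_psi \<alpha> t)) \<ge> 0"
    by (rule Liminf_bounded)
  also have "Liminf at_top (\<lambda>t::real. ereal (t * dirichlet_psi \<alpha> t)) \<le> dirichlet_const \<alpha>"
    unfolding dirichlet_const_def by (intro Liminf_le_Limsup) simp
  finally show "0 \<le> dirichlet_const \<alpha>" .
  have "((\<lambda>t::real. t / (t - 1)) \<longlongrightarrow> 1) at_top" by real_asymp
  then have lim: "((\<lambda>t::real. ereal (t / (t - 1))) \<longlongrightarrow> 1) at_top"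
    by (simp add: one_ereal_def)
  have "dirichlet_const \<alpha> \<le> Limsup at_top (\<lambda>t::real. ereal (t / (t - 1)))"
    unfolding dirichlet_const_def
    by (intro Limsup_mono eventually_mono[OF eventually_ge_at_top[of "2::real"]])
       (simp add: dirichlet_psi_upper)
  also have "\<dots> = 1" using lim by (intro lim_imp_Limsup) simp_all
  finally show "dirichlet_const \<alpha> \<le> 1" .
qed

lemma dirichlet_spectrum_eq: "ereal ` dirichlet_spectrum = range dirichlet_const"
proof (intro equalityI subsetI)
  fix e assume "e \<in> ereal ` dirichlet_spectrum"
  then obtain d where d: "d \<in> dirichlet_spectrum" "e = ereal d" by blast
  then obtain \<alpha> where "dirichlet_const \<alpha> = ereal d" unfolding dirichlet_spectrum_def by blast
  with d(2) have "e = dirichlet_const \<alpha>" by simp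
  then show "e \<in> range dirichlet_const" by (rule range_eqI)
next
  fix e assume "e \<in> range dirichlet_const"
  then obtain \<alpha> where \<alpha>: "e = dirichlet_const \<alpha>" by blast
  obtain d where d: "dirichlet_const \<alpha> = ereal d"
    using dirichlet_const_bounds[of \<alpha>] by (cases "dirichlet_const \<alpha>") auto
  then have "d \<in> dirichlet_spectrum" unfolding dirichlet_spectrum_def by blast
  with \<alpha> d show "e \<in> ereal ` dirichlet_spectrum" by simp
qed

lemma dirichlet_spectrum_subset: "dirichlet_spectrum \<subseteq> {0..1}"
proof
  fix d assume "d \<in> dirichlet_spectrum"
  then obtain \<alpha> where "dirichlet_const \<alpha> = ereal d" unfolding dirichlet_spectrum_def by blast
  then show "d \<in> {0..1}" using dirichlet_const_bounds[of \<alpha>] by simp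
qed

text \<open>The infimum defining \<open>dirichlet_ray_start\<close> is taken over a nonempty set that is bounded
  below, so that the conditionally complete \<open>Inf\<close> on the reals is the true infimum.\<close>

definition dirichlet_ray_start :: real where
  "dirichlet_ray_start = Inf {d::real. {d<..1} \<subseteq> dirichlet_spectrum}"

lemma ray_set_nonempty: "1 \<in> {d::real. {d<..1} \<subseteq> dirichlet_spectrum}"
  by simp

lemma ray_set_bdd_below: "bdd_below {d::real. {d<..1} \<subseteq> dirichlet_spectrum}"
proof (rule bdd_belowI)
  fix d :: real assume "d \<in> {d. {d<..1} \<subseteq> dirichlet_spectrum}"
  then have sub: "{d<..1} \<subseteq> {0..1}" using dirichlet_spectrum_subset by auto
  show "0 \<le> d"
  proof (rule ccontr)
    assume "\<not> 0 \<le> d"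
    then have "d / 2 \<in> {d<..1}" "d / 2 < 0" by auto
    with subsetD[OF sub, of "d / 2"] show False by simp
  qed
qed

end

theory Submission
  imports Defs
begin

text \<open>
  If \<open>\<alpha> = [0; c\<^sub>0, c\<^sub>1, \<dots>]\<close>, then \<open>d(\<alpha>) = M / (M + 1)\<close>, where \<open>M\<close> is the upper limit of the
  products \<open>[c\<^sub>n; c\<^sub>n\<^sub>-\<^sub>1, \<dots>, c\<^sub>0] \<cdot> [c\<^sub>n\<^sub>+\<^sub>1; c\<^sub>n\<^sub>+\<^sub>2, \<dots>]\<close>. It therefore suffices to realise every \<open>M \<ge> 18.4\<close>,
  since \<open>18.4 / 19.4\<close> is below the stated bound.

  Fix neighbouring digits \<open>b\<close>, \<open>a\<close> (\<open>a \<ge> 4\<close> and \<open>b \<in> {a, a + 1}\<close>) and continue them to both sides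
  by digits at most \<open>4\<close> in which no two digits \<open>4\<close> have distance \<open>1\<close> or \<open>3\<close>. The Cantor set of such
  tails has thickness greater than \<open>1\<close> even in logarithmic scale, so by the argument of Hall
  and Newhouse the products \<open>[a; \<dots>] \<cdot> [b; \<dots>]\<close> fill whole intervals, which together cover
  \<open>[18.4, \<infinity>)\<close>. No product at another place exceeds \<open>M\<close>: two digits at most \<open>4\<close>, not both \<open>4\<close>, give
  at most \<open>5 \<cdot> 4 = 20\<close>, which is enough unless \<open>a = b = 4\<close>; and in general the critical pair
  \<open>4, 3\<close> gives at most \<open>29/6 \<cdot> 19/5 < 18.4\<close>, because the factors \<open>4 3 1 4\<close> and \<open>4 1 3 4\<close> do not
  occur. Joining longer and longer finite pieces of such two-sided sequences by single digits \<open>2\<close>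
  yields a number \<open>\<alpha>\<close> for which the upper limit of the products is exactly \<open>M\<close>.
\<close>

subsection \<open>Continued fractions and the Dirichlet constant\<close>

fun cf :: "nat list \<Rightarrow> real \<Rightarrow> real" where
  "cf [] t = t"
| "cf (c # w) t = real c + 1 / cf w t"

lemma cf_append: "cf (v @ w) t = cf v (cf w t)"
  by (induction v) auto

lemma cf_ge1:
  assumes "\<forall>c\<in>set w. 1 \<le> c" "1 \<le> t"
  shows "1 \<le> cf w t"
  using assms
proof (induction w)
  case (Cons c w)
  have "1 \<le> real c" using Cons.prems by auto
  moreover have "0 \<le> 1 / cf w t" using Cons by auto
  ultimately have "1 \<le> real c + 1 / cf w t" by linarith
  then show ?case by simp
qed simp

text \<open>Two digits \<open>c\<close>, \<open>d\<close> at the front divide the distance of the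
  inner values by \<open>(d * x + 1) * (d * y + 1)\<close>, which is at least 4; this is a factor
  1/2 per digit, so the induction removes two digits at a time.\<close>

lemma cf_contract:
  assumes "\<forall>c\<in>set w. 1 \<le> c" "1 \<le> s" "1 \<le> t" "w \<noteq> []"
  shows "\<bar>cf w s - cf w t\<bar> \<le> 4 * (1/2) ^ length w"
  using assms
proof (induction w rule: induct_list012)
  case 1
  then show ?case by simp
next
  case (2 c)
  have "0 < 1/s" "1/s \<le> 1" "0 < 1/t" "1/t \<le> 1" using 2 by auto
  then have "\<bar>1/s - 1/t\<bar> \<le> 2" by linarith
  then show ?case by simp
next
  case (3 c d w)
  let ?x = "cf w s" let ?y = "cf w t"
  have d: "1 \<le> real d" using 3 by auto
  have x: "1 \<le> ?x" "1 \<le> ?y" using 3 by (auto intro!: cf_ge1)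
  have pos: "0 < d * ?x + 1" "0 < d * ?y + 1" using x d by (auto intro!: add_nonneg_pos)
  have eq: "cf (c # d # w) s - cf (c # d # w) t = (?x - ?y) / ((d * ?x + 1) * (d * ?y + 1))"
  proof -
    have "1 / (d + 1 / ?x) = ?x / (d * ?x + 1)" "1 / (d + 1 / ?y) = ?y / (d * ?y + 1)"
      using x pos by (auto simp: field_simps)
    moreover have "?x / (d * ?x + 1) - ?y / (d * ?y + 1) = (?x - ?y) / ((d * ?x + 1) * (d * ?y + 1))"
      using pos by (simp add: field_simps)
    ultimately show ?thesis by simp
  qed
  have ge: "?x + 1 \<le> d * ?x + 1" "?y + 1 \<le> d * ?y + 1"
    using x d by (auto simp: mult_le_cancel_right1)
  have four: "4 \<le> (d * ?x + 1) * (d * ?y + 1)"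
    using mult_mono[of 2 "d * ?x + 1" 2 "d * ?y + 1"] ge x by auto
  show ?case
  proof (cases "w = []")
    case True
    have ss: "(s + 1) * (t + 1) \<le> (d * ?x + 1) * (d * ?y + 1)"
      using ge True x by (intro mult_mono) auto
    \<comment> \<open>The last entries \<open>s\<close> and \<open>t\<close> are unbounded, so the
      factor 4 is of no help here; the denominators themselves absorb their distance.\<close>
    have "\<bar>s - t\<bar> \<le> (s + 1) * (t + 1)"
      using 3(4,5) by (auto simp: algebra_simps abs_le_iff)
    then have "\<bar>(?x - ?y) / ((d * ?x + 1) * (d * ?y + 1))\<bar> \<le> 1"
      using ss pos True by (simp add: abs_mult divide_le_eq)
    then show ?thesis unfolding eq using True by (simp add: power2_eq_square)
  next
    case False
    have "\<bar>?x - ?y\<bar> / ((d * ?x + 1) * (d * ?y + 1)) \<le> \<bar>?x - ?y\<bar> / 4"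
      using four by (intro divide_left_mono) auto
    also have "\<dots> \<le> (4 * (1/2) ^ length w) / 4"
      using 3 False by (intro divide_right_mono) auto
    finally have "\<bar>(?x - ?y) / ((d * ?x + 1) * (d * ?y + 1))\<bar> \<le> (1/2) ^ length w"
      using pos by (simp add: abs_mult)
    then show ?thesis unfolding eq by (simp add: power2_eq_square)
  qed
qed

text \<open>Each \<open>z n\<close> is the limit of the finite continued fractions formed from the
  digits \<open>c n\<close>, \<open>c (n + 1)\<close> and so on, which are Cauchy by
  \<open>cf_contract\<close>; the recursion passes to the limit.\<close>

lemma complete_quotients_exist:
  fixes c :: "nat \<Rightarrow> nat"
  assumes c: "\<And>n. 1 \<le> c n"
  obtains z where "\<And>n. z n = real (c n) + 1 / z (Suc n)" "\<And>n. 1 < z n"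
proof -
  define f where "f n m = cf (map c [n..<n+m]) 1" for n m
  have f1: "1 \<le> f n m" for n m unfolding f_def using c by (intro cf_ge1) auto
  have split: "f n (m + k) = cf (map c [n..<n+m]) (f (n + m) k)" for n m k
    unfolding f_def using upt_add_eq_append[of n "n+m" k]
    by (simp add: cf_append[symmetric] add.assoc)
  have Suc_f: "f n (Suc m) = c n + 1 / f (Suc n) m" for n m
    using split[of n 1 m] by simp
  have close: "\<bar>f n (m + k) - f n m\<bar> \<le> 4 * (1/2) ^ m" if "0 < m" for n m k
    unfolding split using cf_contract[of "map c [n..<n+m]" "f (n+m) k" 1] c f1 that
    by (auto simp: f_def)
  have "Cauchy (f n)" for n
  proof (rule metric_CauchyI)
    fix e :: real assume "0 < e"
    have "(\<lambda>m. 4 * (1/2::real) ^ m) \<longlonglongrightarrow> 0" by real_asymp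
    then have "eventually (\<lambda>m. 4 * (1/2::real) ^ m < e / 2) sequentially"
      using \<open>0 < e\<close> by (intro order_tendstoD(2)[where y = 0]) auto
    then obtain M where M: "\<And>m. M \<le> m \<Longrightarrow> 4 * (1/2::real) ^ m < e / 2"
      by (auto simp: eventually_sequentially)
    let ?M = "Suc M"
    have "dist (f n m) (f n ?M) < e / 2" if "?M \<le> m" for m
      using close[of ?M n "m - ?M"] M[of ?M] that by (simp add: dist_real_def)
    then show "\<exists>M. \<forall>m\<ge>M. \<forall>k\<ge>M. dist (f n m) (f n k) < e"
      by (meson dist_triangle_half_l)
  qed
  then have "\<exists>l. f n \<longlonglongrightarrow> l" for n
    using Cauchy_convergent convergent_def by blast
  then obtain z where z: "\<And>n. f n \<longlonglongrightarrow> z n" by metis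
  have z1: "1 \<le> z n" for n
    using z[of n] f1 by (intro LIMSEQ_le_const) auto
  have rec: "z n = c n + 1 / z (Suc n)" for n
  proof -
    have "(\<lambda>m. f n (Suc m)) \<longlonglongrightarrow> z n" using z LIMSEQ_Suc by blast
    moreover have "(\<lambda>m. c n + 1 / f (Suc n) m) \<longlonglongrightarrow> c n + 1 / z (Suc n)"
      using z z1[of "Suc n"] by (intro tendsto_intros) auto
    ultimately show ?thesis using Suc_f LIMSEQ_unique by force
  qed
  moreover have "1 < z n" for n
  proof -
    have "0 < 1 / z (Suc n)" using z1[of "Suc n"] by simp
    then show ?thesis using rec[of n] c[of n] by linarith
  qed
  ultimately show ?thesis using that by blast
qed

lemma Limsup_eqI:
  fixes f :: "'a \<Rightarrow> 'b :: complete_linorder"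
  assumes "\<And>y. l < y \<Longrightarrow> eventually (\<lambda>x. f x < y) F"
    and "\<And>y. y < l \<Longrightarrow> frequently (\<lambda>x. y < f x) F"
  shows "Limsup F f = l"
proof (rule antisym)
  show "Limsup F f \<le> l" using assms(1) by (simp add: Limsup_le_iff)
  show "l \<le> Limsup F f"
  proof (rule ccontr)
    assume "\<not> l \<le> Limsup F f"
    then have less: "Limsup F f < l" by simp
    show False
    proof (cases "\<exists>y. Limsup F f < y \<and> y < l")
      case True
      then obtain y where y: "Limsup F f < y" "y < l" by blast
      then have "eventually (\<lambda>x. f x < y) F" by (rule_tac Limsup_lessD) auto
      with assms(2)[OF y(2)] show False
        by (smt (verit) eventually_mono frequently_def less_asym)
    next
      \<comment> \<open>Nothing lies strictly between the upper limit and \<open>l\<close>, so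
        \<open>f x < l\<close> already forces \<open>f x\<close> not to exceed the upper
        limit.\<close>
      case False
      have "eventually (\<lambda>x. f x < l) F" using less by (rule_tac Limsup_lessD) auto
      then have "eventually (\<lambda>x. \<not> Limsup F f < f x) F"
        by eventually_elim (use False in blast)
      with assms(2)[OF less] show False by (simp add: frequently_def)
    qed
  qed
qed

section \<open>Convergents, best approximation, and the Dirichlet constant in terms of
  products\<close>

locale continued_fraction =
  fixes c :: "nat \<Rightarrow> nat" and z :: "nat \<Rightarrow> real"
  assumes c: "1 \<le> c n" and z_rec: "z n = real (c n) + 1 / z (Suc n)" and z_gt1: "1 < z n"
begin

fun den :: "nat \<Rightarrow> int" where
  "den 0 = 1"
| "den (Suc 0) = int (c 0)"
| "den (Suc (Suc n)) = int (c (Suc n)) * den (Suc n) + den n"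

fun num :: "nat \<Rightarrow> int" where
  "num 0 = 0"
| "num (Suc 0) = 1"
| "num (Suc (Suc n)) = int (c (Suc n)) * num (Suc n) + num n"

text \<open>\<open>bwd n = [c n; c (n - 1), \<dots>, c 0]\<close>.\<close>

fun bwd :: "nat \<Rightarrow> real" where
  "bwd 0 = real (c 0)"
| "bwd (Suc n) = real (c (Suc n)) + 1 / bwd n"

text \<open>By \<open>den_alpha\<close> this product is the distance from
  \<open>den n * alpha\<close> to \<open>num n\<close>.\<close>

definition err :: "nat \<Rightarrow> real" where "err n = (\<Prod>i\<le>n. 1 / z i)"

definition alpha :: real where "alpha = 1 / z 0"

lemma c_real: "1 \<le> real (c n)" using c by simp

lemma err_Suc: "err (Suc n) = err n / z (Suc n)"
  by (simp add: err_def)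

lemma err_pos: "0 < err n"
  unfolding err_def using z_gt1 by (intro prod_pos) (auto intro: less_trans[OF zero_less_one])

lemma err_Suc_Suc: "err (Suc (Suc n)) = err n - c (Suc n) * err (Suc n)"
proof -
  have z: "z (Suc n) \<noteq> 0" "z (Suc (Suc n)) \<noteq> 0"
    using z_gt1[of "Suc n"] z_gt1[of "Suc (Suc n)"] by auto
  have "err n = z (Suc n) * err (Suc n)" using z by (simp add: err_Suc)
  also have "\<dots> = (c (Suc n) + 1 / z (Suc (Suc n))) * err (Suc n)"
    using z_rec[of "Suc n"] by simp
  also have "\<dots> = c (Suc n) * err (Suc n) + err (Suc (Suc n))"
    by (simp add: err_Suc[of "Suc n"] algebra_simps)
  finally show ?thesis by simp
qed

lemma first_step: "c 0 * (1 / z 0) + 1 / z 0 * (1 / z (Suc 0)) = 1"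
proof -
  have "(c 0 + 1 / z (Suc 0)) * (1 / z 0) = 1" using z_rec[of 0] z_gt1[of 0] by simp
  then show ?thesis by (simp add: algebra_simps)
qed

lemma den_ge1: "1 \<le> den n"
proof (induction n rule: den.induct)
  case (3 n)
  have "0 \<le> int (c (Suc n)) * den (Suc n)" using 3 by auto
  then show ?case using 3 unfolding den.simps by linarith
qed (use c in \<open>auto simp: Suc_le_eq\<close>)

lemma den_mono: "den n \<le> den (Suc n)"
proof (cases n)
  case 0
  then show ?thesis using c[of 0] by simp
next
  case (Suc m)
  have "1 * den (Suc m) \<le> int (c (Suc m)) * den (Suc m)"
    using c[of "Suc m"] den_ge1[of "Suc m"] by (intro mult_right_mono) auto
  then show ?thesis using den_ge1[of m] by (simp add: Suc)
qed

lemma den_strict_mono: "den (Suc n) < den (Suc (Suc n))"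
proof -
  have "1 * den (Suc n) \<le> int (c (Suc n)) * den (Suc n)"
    using c[of "Suc n"] den_ge1[of "Suc n"] by (intro mult_right_mono) auto
  then show ?thesis using den_ge1[of n] by simp
qed

lemma den_ge: "int n \<le> den n"
proof (induction n)
  case (Suc n)
  show ?case
  proof (cases n)
    case 0
    then show ?thesis using c[of 0] by simp
  next
    case (Suc m)
    then show ?thesis using Suc.IH den_strict_mono[of m] by simp
  qed
qed simp

lemma den_alpha: "den n * alpha - num n = (-1) ^ n * err n"
proof (induction n rule: den.induct)
  case 1
  then show ?case by (simp add: alpha_def err_def)
next
  case 2
  show ?case using first_step by (simp add: alpha_def err_def)
next
  case (3 n)
  have "den (Suc (Suc n)) * alpha - num (Suc (Suc n))
      = c (Suc n) * (den (Suc n) * alpha - num (Suc n)) + (den n * alpha - num n)"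
    by (simp add: algebra_simps)
  also have "\<dots> = (-1) ^ n * (err n - c (Suc n) * err (Suc n))"
    unfolding 3 by (simp add: algebra_simps)
  finally show ?case by (simp add: err_Suc_Suc)
qed

lemma wronskian: "den (Suc n) * err n + den n * err (Suc n) = 1"
proof (induction n)
  case 0
  show ?case using first_step by (simp add: err_def)
next
  case (Suc n)
  then show ?case by (simp add: err_Suc_Suc algebra_simps)
qed

lemma determinant: "num (Suc n) * den n - num n * den (Suc n) = (-1) ^ n"
  by (induction n) (simp_all add: algebra_simps)

lemma bwd_ge1: "1 \<le> bwd n"
proof (induction n)
  case (Suc n)
  have "0 \<le> 1 / bwd n" using Suc by simp
  then have "1 \<le> real (c (Suc n)) + 1 / bwd n" using c_real[of "Suc n"] by linarith
  then show ?case by simp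
qed (use c_real in simp)

lemma bwd_eq: "bwd n = den (Suc n) / den n"
proof (induction n)
  case (Suc n)
  have "bwd (Suc n) = c (Suc n) + den n / den (Suc n)" by (simp add: Suc)
  then show ?case using den_ge1[of "Suc n"] by (simp add: field_simps)
qed simp

text \<open>This is \<open>wronskian\<close> rewritten with
  \<open>err (Suc n) = err n / z (Suc n)\<close> and
  \<open>den n = den (Suc n) / bwd n\<close>.\<close>

lemma den_err: "den (Suc n) * err n = 1 / (1 + 1 / (bwd n * z (Suc n)))"
proof -
  have z: "0 < z (Suc n)" using z_gt1[of "Suc n"] by simp
  have d: "0 < real_of_int (den n)" "0 < real_of_int (den (Suc n))"
    using den_ge1[of n] den_ge1[of "Suc n"] by auto
  have "den (Suc n) * err n * (1 + 1 / (bwd n * z (Suc n))) = den (Suc n) * err n + den n * err (Suc n)"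
    using z d by (simp add: bwd_eq err_Suc distrib_left)
  then have "den (Suc n) * err n * (1 + 1 / (bwd n * z (Suc n))) = 1" using wronskian by simp
  moreover have "0 < 1 + 1 / (bwd n * z (Suc n))"
    using z bwd_ge1[of n] by (intro add_pos_pos) auto
  ultimately show ?thesis by (simp add: field_simps)
qed

text \<open>Since consecutive convergents have determinant 1 or -1, \<open>(q, p)\<close> is an
  integer combination of them with coefficients \<open>u\<close> and \<open>v\<close>. The size of
  \<open>q\<close> forces \<open>u\<close> to be nonzero and \<open>v\<close> to be zero or of the
  opposite sign; as the two errors alternate in sign, their contributions add up instead of
  cancelling.\<close>

lemma best_approximation:
  assumes q: "1 \<le> q" "q < den (Suc n)"
  shows "err n \<le> \<bar>q * alpha - real_of_int p\<bar>"
proof -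
  define e :: int where "e = (-1) ^ n"
  have e: "e * e = 1" unfolding e_def by (simp add: power_mult_distrib[symmetric])
  define u where "u = e * (q * num (Suc n) - p * den (Suc n))"
  define v where "v = e * (p * den n - q * num n)"
  have det: "num (Suc n) * den n - num n * den (Suc n) = e"
    using determinant by (simp add: e_def)
  have "u * den n + v * den (Suc n) = e * q * (num (Suc n) * den n - num n * den (Suc n))"
    by (simp add: u_def v_def algebra_simps)
  also have "\<dots> = (e * e) * q" by (simp add: det)
  finally have qe: "u * den n + v * den (Suc n) = q" by (simp add: e)
  have "u * num n + v * num (Suc n) = e * p * (num (Suc n) * den n - num n * den (Suc n))"
    by (simp add: u_def v_def algebra_simps)
  also have "\<dots> = (e * e) * p" by (simp add: det)
  finally have pe: "u * num n + v * num (Suc n) = p" by (simp add: e)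
  have "q * alpha - p = real_of_int u * (den n * alpha - num n) + v * (den (Suc n) * alpha - num (Suc n))"
    unfolding qe[symmetric] pe[symmetric] by (simp add: algebra_simps)
  also have "\<dots> = (-1) ^ n * (u * err n - v * err (Suc n))"
    unfolding den_alpha by (simp add: algebra_simps)
  finally have eq: "\<bar>q * alpha - p\<bar> = \<bar>u * err n - v * err (Suc n)\<bar>"
    by (simp add: abs_mult)
  have u0: "u \<noteq> 0"
  proof
    assume "u = 0"
    then have "v * den (Suc n) = q" using qe by simp
    then have "0 < v * den (Suc n)" using q by simp
    then have "0 < v" using den_ge1[of "Suc n"] by (simp add: zero_less_mult_iff)
    then have "1 * den (Suc n) \<le> v * den (Suc n)"
      using den_ge1[of "Suc n"] by (intro mult_right_mono) auto
    then show False using \<open>v * den (Suc n) = q\<close> q by simp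
  qed
  consider "0 < u" | "u < 0" using u0 by linarith
  then show ?thesis
  proof cases
    case 1
    have "v \<le> 0"
    proof (rule ccontr)
      assume "\<not> v \<le> 0"
      then have "1 * den (Suc n) \<le> v * den (Suc n)"
        using den_ge1[of "Suc n"] by (intro mult_right_mono) auto
      moreover have "0 < u * den n" using 1 den_ge1[of n] by simp
      ultimately show False using q qe by linarith
    qed
    then have "v * err (Suc n) \<le> 0" using err_pos[of "Suc n"] by (simp add: mult_le_0_iff)
    moreover have "1 * err n \<le> u * err n"
      using 1 err_pos[of n] by (intro mult_right_mono) auto
    ultimately show ?thesis unfolding eq by linarith
  next
    case 2
    have "0 \<le> v"
    proof (rule ccontr)
      assume "\<not> 0 \<le> v"
      then have "v * den (Suc n) \<le> 0" using den_ge1[of "Suc n"] by (simp add: mult_le_0_iff)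
      moreover have "u * den n \<le> 0" using 2 den_ge1[of n] by (simp add: mult_le_0_iff)
      ultimately show False using q qe by linarith
    qed
    then have "0 \<le> v * err (Suc n)" using err_pos[of "Suc n"] by simp
    moreover have "u * err n \<le> -1 * err n"
      using 2 err_pos[of n] by (intro mult_right_mono) auto
    ultimately show ?thesis unfolding eq by linarith
  qed
qed

lemma dirichlet_psi_eq:
  fixes t :: real
  assumes t: "den n \<le> t" "t < den (Suc n)"
  shows "dirichlet_psi alpha t = err n"
  unfolding dirichlet_psi_def
proof (rule antisym)
  let ?B = "(\<lambda>q. dist_int (of_int q * alpha)) ` {q::int. 1 \<le> q \<and> of_int q \<le> t}"
  have fin: "finite ?B" using finite_int_range by blast
  have mem: "dist_int (den n * alpha) \<in> ?B" using t den_ge1[of n] by auto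
  have "Min ?B \<le> dist_int (den n * alpha)" using fin mem by (rule Min_le)
  also have "\<dots> \<le> \<bar>den n * alpha - num n\<bar>" by (rule dist_int_le)
  also have "\<dots> = err n" unfolding den_alpha using err_pos[of n] by (simp add: abs_mult)
  finally show "Min ?B \<le> err n" .
  have "err n \<le> dist_int (q * alpha)" if "1 \<le> q" "of_int q \<le> t" for q :: int
  proof -
    have "q < den (Suc n)" using that t by linarith
    from best_approximation[OF that(1) this]
    \<comment> \<open>The two candidates for the nearest integer.\<close>
    have "err n \<le> \<bar>q * alpha - \<lfloor>q * alpha\<rfloor>\<bar>" "err n \<le> \<bar>q * alpha - (\<lfloor>q * alpha\<rfloor> + 1)\<bar>"
      by (metis of_int_1 of_int_add)+
    then show ?thesis unfolding dist_int_def frac_def by linarith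
  qed
  then show "err n \<le> Min ?B" using fin mem by (subst Min_ge_iff) auto
qed

lemma err_tendsto_0: "err \<longlonglongrightarrow> 0"
proof (rule tendsto_sandwich[of "\<lambda>_. 0" _ _ "\<lambda>n. 1 / real n"])
  show "\<forall>\<^sub>F n in sequentially. err n \<le> 1 / real n"
    using eventually_gt_at_top[of 0]
  proof eventually_elim
    case (elim n)
    have "real n \<le> den (Suc n)" using den_ge[of "Suc n"] by linarith
    then have "real n * err n \<le> den (Suc n) * err n" using err_pos[of n]
      by (intro mult_right_mono) auto
    also have "\<dots> \<le> 1"
      using wronskian[of n] den_ge1[of n] err_pos[of "Suc n"]
      by (smt (verit) mult_nonneg_nonneg of_int_1_le_iff)
    finally show ?case using elim by (simp add: field_simps)
  qed
qed (use less_imp_le[OF err_pos] in \<open>simp_all add: lim_1_over_n\<close>)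

text \<open>For \<open>t\<close> from \<open>den n\<close> up to \<open>den (Suc n)\<close> the
  function \<open>t * dirichlet_psi alpha t\<close> is linear with slope \<open>err n\<close>. Its
  supremum there, approached at the right end, is \<open>den (Suc n) * err n\<close>, which
  \<open>den_err\<close> evaluates.\<close>

lemma dirichlet_const_eq:
  assumes up: "\<And>y. l < y \<Longrightarrow> \<forall>\<^sub>F n in sequentially. 1 / (1 + 1 / (bwd n * z (Suc n))) < y"
    and low: "\<And>y. y < l \<Longrightarrow> \<exists>\<^sub>F n in sequentially. y < 1 / (1 + 1 / (bwd n * z (Suc n)))"
  shows "dirichlet_const alpha = ereal l"
  unfolding dirichlet_const_def
proof (rule Limsup_eqI)
  fix y' assume "ereal l < y'"
  then obtain y where y: "l < y" "ereal y < y'" 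
    by (metis ereal_dense2 ereal_less(2) less_ereal.simps(1))
  obtain N where N: "\<And>n. N \<le> n \<Longrightarrow> den (Suc n) * err n < y"
    using up[OF y(1)] unfolding eventually_sequentially den_err by blast
  have "t * dirichlet_psi alpha t < y" if t: "den N \<le> t" for t :: real
  proof -
    have "\<exists>n. t < den (Suc n)"
      using den_ge[of "Suc (nat \<lceil>t\<rceil>)"]
      by (intro exI[of _ "nat \<lceil>t\<rceil>"]) linarith
    define n where "n = (LEAST n. t < den (Suc n))"
    have n: "t < den (Suc n)" unfolding n_def by (rule LeastI_ex) fact
    have "N \<le> n"
    proof (rule ccontr)
      assume "\<not> N \<le> n"
      then have "den (Suc n) \<le> den N" using lift_Suc_mono_le[of den] den_mono by auto
      then show False using n t by linarith
    qed
    have "den n \<le> t"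
    proof (cases "n = N")
      case False
      then have "n - 1 < n" "Suc (n - 1) = n" using \<open>N \<le> n\<close> by auto
      then show ?thesis using not_less_Least[of "n - 1" "\<lambda>n. t < den (Suc n)"]
        by (simp add: n_def)
    qed (use t in simp)
    then have "t * dirichlet_psi alpha t = t * err n" using n by (simp add: dirichlet_psi_eq)
    also have "\<dots> < den (Suc n) * err n" using n err_pos by (intro mult_strict_right_mono) auto
    also have "\<dots> < y" using N \<open>N \<le> n\<close> by simp
    finally show ?thesis .
  qed
  then have "\<forall>t\<ge>real_of_int (den N). ereal (t * dirichlet_psi alpha t) < y'"
    using y(2) by (meson less_ereal.simps(1) less_trans)
  then show "\<forall>\<^sub>F t in at_top. ereal (t * dirichlet_psi alpha t) < y'"
    unfolding eventually_at_top_linorder by blast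
next
  fix y' assume "y' < ereal l"
  then obtain y where y: "y < l" "y' < ereal y" 
    by (metis ereal_dense2 less_ereal.simps(1))
  have "(y + l) / 2 < l" using y by simp
  have e: "\<forall>\<^sub>F n in sequentially. err n < (l - y) / 2"
    using y by (intro order_tendstoD(2)[OF err_tendsto_0]) auto
  show "\<exists>\<^sub>F t in at_top. y' < ereal (t * dirichlet_psi alpha t)"
    unfolding frequently_def
  proof
    assume "\<forall>\<^sub>F t in at_top. \<not> y' < ereal (t * dirichlet_psi alpha t)"
    then obtain T where T: "\<And>t. T \<le> t \<Longrightarrow> \<not> y' < ereal (t * dirichlet_psi alpha t)"
      by (auto simp: eventually_at_top_linorder)
    \<comment> \<open>The supremum is not attained, so \<open>t = den (Suc n) - 1\<close> is used,
      at a loss of \<open>err n\<close>; the midpoint of \<open>y\<close> and \<open>l\<close>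
      leaves room for this loss. The last condition gives \<open>T \<le> t\<close> and also
      \<open>n > 0\<close>, without which \<open>den n\<close> and \<open>den (Suc n)\<close> might
      coincide.\<close>
    obtain n where n: "(y + l) / 2 < den (Suc n) * err n" "err n < (l - y) / 2" "nat \<lceil>T\<rceil> + 1 \<le> n"
      using frequently_ex[OF frequently_eventually_conj[OF low[OF \<open>(y + l) / 2 < l\<close>]
        eventually_conj[OF e eventually_ge_at_top[of "nat \<lceil>T\<rceil> + 1"]]]]
      unfolding den_err by blast
    define t where "t = real_of_int (den (Suc n)) - 1"
    obtain m where m: "n = Suc m" using n(3) by (cases n) auto
    have "den n \<le> t" "t < den (Suc n)" using den_strict_mono[of m] unfolding t_def m
      by linarith+
    then have "t * dirichlet_psi alpha t = den (Suc n) * err n - err n"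
      by (simp add: dirichlet_psi_eq) (simp add: t_def algebra_simps)
    also have "\<dots> > y" using n by (simp add: field_simps)
    finally have "y' < ereal (t * dirichlet_psi alpha t)" using y(2)
      by (meson less_ereal.simps(1) less_trans)
    moreover have "T \<le> t" using den_ge[of "Suc n"] n(3) unfolding t_def by linarith
    ultimately show False using T by blast
  qed
qed

lemma z_cf: "z i = cf (map c [i..<i + k]) (z (i + k))"
proof (induction k arbitrary: i)
  case (Suc k)
  have "map c [i..<i + Suc k] = c i # map c [Suc i..<Suc i + k]" by (simp add: upt_rec)
  then show ?case using Suc[of "Suc i"] z_rec[of i] by simp
qed simp

lemma bwd_cf: "bwd (i + k) = cf (rev (map c [Suc i..<Suc (i + k)])) (bwd i)"
  by (induction k) (simp_all add: cf_append)

lemma bwd_bounds: "c i \<le> bwd i" "bwd i \<le> real (c i) + 1"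
proof -
  have "0 \<le> 1 / bwd j \<and> 1 / bwd j \<le> 1" for j using bwd_ge1[of j] by simp
  then show "c i \<le> bwd i" "bwd i \<le> real (c i) + 1" by (cases i; simp)+
qed

lemma z_bounds: "c i \<le> z i" "z i \<le> real (c i) + 1"
proof -
  have "0 \<le> 1 / z (Suc i) \<and> 1 / z (Suc i) \<le> 1" using z_gt1[of "Suc i"] by simp
  then show "c i \<le> z i" "z i \<le> real (c i) + 1" using z_rec[of i] by linarith+
qed

lemma dirichlet_const_products:
  assumes M: "0 < M"
    and up: "\<And>B. M < B \<Longrightarrow> \<forall>\<^sub>F i in sequentially. bwd i * z (Suc i) < B"
    and low: "\<And>B. B < M \<Longrightarrow> \<exists>\<^sub>F i in sequentially. B < bwd i * z (Suc i)"
  shows "dirichlet_const alpha = ereal (M / (M + 1))"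
proof (rule dirichlet_const_eq)
  have pos: "0 < bwd i * z (Suc i)" for i
    using bwd_ge1[of i] z_gt1[of "Suc i"] by (intro mult_pos_pos) linarith+
  have conv: "1 / (1 + 1 / P) = P / (P + 1)" if "0 < P" for P :: real using that
    by (simp add: field_simps)
  fix y :: real
  show "\<forall>\<^sub>F n in sequentially. 1 / (1 + 1 / (bwd n * z (Suc n))) < y"
    if y: "M / (M + 1) < y"
  proof (cases "y < 1")
    case True
    then have "M < y / (1 - y)" using y M by (simp add: field_simps)
    from up[OF this] show ?thesis
    proof eventually_elim
      case (elim n)
      then show ?case unfolding conv[OF pos] using pos[of n] True by (simp add: field_simps)
    qed
  next
    case False
    have "1 / (1 + 1 / (bwd n * z (Suc n))) < 1" for n unfolding conv[OF pos] using pos[of n]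
      by simp
    then show ?thesis using False by (intro always_eventually) (meson less_le_trans not_less)
  qed
  show "\<exists>\<^sub>F n in sequentially. y < 1 / (1 + 1 / (bwd n * z (Suc n)))"
    if y: "y < M / (M + 1)"
  proof -
    have "M / (M + 1) < 1" using M by simp
    then have y1: "y < 1" using y by linarith
    then have "y / (1 - y) < M" using y M by (simp add: field_simps)
    from low[OF this] show ?thesis
    proof (rule frequently_elim1)
      fix n assume "y / (1 - y) < bwd n * z (Suc n)"
      then show "y < 1 / (1 + 1 / (bwd n * z (Suc n)))"
        unfolding conv[OF pos] using pos[of n] y1 by (simp add: field_simps)
    qed
  qed
qed

end

subsection \<open>Products of two Cantor sets\<close>

text \<open>The phase of a word records how long ago its last digit \<open>4\<close> occurred.\<close>

datatype phase = Free | After4 | Second | Third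

fun max_digit :: "phase \<Rightarrow> nat" where
  "max_digit Free = 4" | "max_digit After4 = 3" | "max_digit Second = 4" | "max_digit Third = 3"

text \<open>Remembering only the last \<open>4\<close> suffices: if two digits \<open>4\<close> have
  distance 2, the place at distance 3 from the first comes right after the second and is barred by
  \<open>After4\<close>.\<close>

fun next_phase :: "phase \<Rightarrow> nat \<Rightarrow> phase" where
  "next_phase s d = (if d = 4 then After4 else case s of
     Free \<Rightarrow> Free | After4 \<Rightarrow> Second | Second \<Rightarrow> Third | Third \<Rightarrow> Free)"

text \<open>Values \<open>t\<close> of \<open>[0; \<dots>]\<close> in the interval from \<open>inf_tail s\<close> to \<open>sup_tail s\<close> may follow a word of
  phase \<open>s\<close>. These rational intervals lie inside the true hulls of the Cantor set (\<open>tail_cover\<close>),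
  so refining a word by a further digit never loses points.\<close>

fun inf_tail :: "phase \<Rightarrow> real" where
  "inf_tail Free = 2072/10000" | "inf_tail After4 = 2637/10000"
| "inf_tail Second = 2072/10000" | "inf_tail Third = 2613/10000"

fun sup_tail :: "phase \<Rightarrow> real" where
  "sup_tail Free = 8283/10000" | "sup_tail After4 = 8283/10000"
| "sup_tail Second = 7928/10000" | "sup_tail Third = 8283/10000"

fun legal :: "phase \<Rightarrow> nat list \<Rightarrow> bool" where
  "legal s [] = True"
| "legal s (d # w) = (1 \<le> d \<and> d \<le> max_digit s \<and> legal (next_phase s d) w)"

section \<open>Numerical estimates for bridges and gaps\<close>

definition digit_lo :: "phase \<Rightarrow> nat \<Rightarrow> real"
  where "digit_lo s d = d + inf_tail (next_phase s d)"
definition digit_hi :: "phase \<Rightarrow> nat \<Rightarrow> real"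
  where "digit_hi s d = d + sup_tail (next_phase s d)"

lemma phase_digit_cases:
  assumes "1 \<le> j" "j < max_digit s"
  obtains "s = Free" "j = 1" | "s = Free" "j = 2" | "s = Free" "j = 3"
  | "s = After4" "j = 1" | "s = After4" "j = 2"
  | "s = Second" "j = 1" | "s = Second" "j = 2" | "s = Second" "j = 3"
  | "s = Third" "j = 1" | "s = Third" "j = 2"
proof -
  have "j = 1 \<or> j = 2 \<or> j = 3" using assms by (cases s) auto
  then show ?thesis using assms that by (cases s) auto
qed

lemma endpoints_less:
  assumes "1 \<le> j" "j < max_digit s"
  shows "1 \<le> digit_lo s j" "digit_lo s j < digit_hi s j" "digit_hi s j < digit_lo s (Suc j)"
      "digit_lo s (Suc j) < digit_hi s (max_digit s)"
  using assms by (cases rule: phase_digit_cases, simp_all add: digit_lo_def digit_hi_def)+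

text \<open>By \<open>cf_diff\<close>, a word maps an interval with endpoints \<open>x\<close>,
  \<open>y\<close> to one of length proportional to \<open>(y - x) / ((x + r) * (y + r))\<close>.
  After cancelling a common factor, both claims say that the image of the bridge on that side of the
  gap is at least 41/40 times as long as the image of the gap. For fixed \<open>s\<close> and
  \<open>j\<close> they are linear in \<open>r\<close>.\<close>

lemma thick:
  assumes "1 \<le> j" "j < max_digit s" "0 \<le> r" "r \<le> (1::real)"
  shows "41/40 * ((digit_lo s (Suc j) - digit_hi s j) * (digit_lo s j + r))
      \<le> (digit_hi s j - digit_lo s j) * (digit_lo s (Suc j) + r)"
    and "41/40 * ((digit_lo s (Suc j) - digit_hi s j) * (digit_hi s (max_digit s) + r))
        \<le> (digit_hi s (max_digit s) - digit_lo s (Suc j)) * (digit_hi s j + r)"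
  using assms(1,2) by (cases rule: phase_digit_cases; simp add: digit_lo_def digit_hi_def; use assms(3,4) in linarith)+

text \<open>The hypotheses compare the Bernstein coefficients of the two quadratics in \<open>r\<close> on \<open>[0, 1]\<close>.\<close>

lemma quadratic_le:
  fixes r :: real
  assumes r: "0 \<le> r" "r \<le> 1"
    and le: "e * (a * b) \<le> f * (x * y)"
      "e * (2 * a * b + a + b) \<le> f * (2 * x * y + x * n + y * m)"
      "e * ((a + 1) * (b + 1)) \<le> f * ((x + m) * (y + n))"
  shows "e * ((a + r) * (b + r)) \<le> f * ((x + m * r) * (y + n * r))"
proof -
  have "0 \<le> (1 - r) * (1 - r) * (f * (x * y) - e * (a * b))" using le by simp
  moreover have "0 \<le> r * (1 - r) * (f * (2 * x * y + x * n + y * m) - e * (2 * a * b + a + b))"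
    using le r by simp
  moreover have "0 \<le> r * r * (f * ((x + m) * (y + n)) - e * ((a + 1) * (b + 1)))" using le
    by simp
  ultimately show ?thesis by (simp add: algebra_simps)
qed

text \<open>The cleared form of the statement that the gap after digit \<open>Suc j\<close> has an
  image at most 3/4 as long as that of the gap after \<open>j\<close>.\<close>

lemma gap_rest:
  assumes "1 \<le> j" "Suc j < max_digit s" "0 \<le> r" "r \<le> (1::real)"
  shows "(digit_lo s (Suc (Suc j)) - digit_hi s (Suc j)) * ((digit_hi s j + r) * (digit_lo s (Suc j) + r))
    \<le> 3/4 * (digit_lo s (Suc j) - digit_hi s j) * ((digit_hi s (Suc j) + r) * (digit_lo s (Suc (Suc j)) + r))"
proof -
  have "j < max_digit s" using assms by simp
  have "(digit_lo s (Suc (Suc j)) - digit_hi s (Suc j)) * ((digit_hi s j + r) * (digit_lo s (Suc j) + r))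
    \<le> 3/4 * (digit_lo s (Suc j) - digit_hi s j) * ((digit_hi s (Suc j) + 1 * r) * (digit_lo s (Suc (Suc j)) + 1 * r))"
    by (rule phase_digit_cases[OF assms(1) \<open>j < max_digit s\<close>]; hypsubst; rule quadratic_le; use assms in \<open>simp add: digit_lo_def digit_hi_def\<close>)
  then show ?thesis by simp
qed

text \<open>The analogue for the first gap inside digit \<open>d\<close>; the further digit inverts
  the variable, whence the factors \<open>(d + r) * y + 1\<close>. The case \<open>d = Suc j\<close>
  serves when \<open>Suc j\<close> is the only digit above the gap.\<close>

lemma gap_digit:
  assumes "1 \<le> j" "j < max_digit s" "d = j \<or> d = Suc j" "0 \<le> r" "r \<le> (1::real)"
  shows "(digit_lo (next_phase s d) 2 - digit_hi (next_phase s d) 1) * ((digit_hi s j + r) * (digit_lo s (Suc j) + r))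
    \<le> 3/4 * (digit_lo s (Suc j) - digit_hi s j) * (((d + r) * digit_hi (next_phase s d) 1 + 1) * ((d + r) * digit_lo (next_phase s d) 2 + 1))"
proof -
  let ?P = "\<lambda>d. (digit_lo (next_phase s d) 2 - digit_hi (next_phase s d) 1) * ((digit_hi s j + r) * (digit_lo s (Suc j) + r))
    \<le> 3/4 * (digit_lo s (Suc j) - digit_hi s j) * ((d * digit_hi (next_phase s d) 1 + 1 + digit_hi (next_phase s d) 1 * r)
      * (d * digit_lo (next_phase s d) 2 + 1 + digit_lo (next_phase s d) 2 * r))"
  have "?P j"
    by (rule phase_digit_cases[OF assms(1,2)]; hypsubst; rule quadratic_le; use assms(4,5)
        in \<open>simp add: digit_lo_def digit_hi_def\<close>)
  moreover have "?P (Suc j)"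
    by (rule phase_digit_cases[OF assms(1,2)]; hypsubst; rule quadratic_le; use assms(4,5)
        in \<open>simp add: digit_lo_def digit_hi_def\<close>)
  ultimately have "?P d" using assms(3) by auto
  then show ?thesis by (simp add: algebra_simps)
qed

lemma tail_cover:
  "1 / digit_hi s (max_digit s) \<le> inf_tail s" "sup_tail s \<le> 1 / digit_lo s 1"
  by (cases s, simp_all add: digit_lo_def digit_hi_def)+

text \<open>As a function of its last entry, \<open>cf w\<close> is fractional linear with
  determinant 1 or -1. Here \<open>r\<close> is the quotient of the last two continuants, which
  starts at 0 and becomes \<open>1 / (c + r)\<close> when a digit \<open>c\<close> is
  appended.\<close>

lemma cf_diff:
  assumes "\<forall>c\<in>set w. 1 \<le> c" "w \<noteq> []"
  obtains k r where "k \<noteq> 0" "0 \<le> r" "r \<le> (1::real)"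
    "\<And>s t. 0 < s \<Longrightarrow> 0 < t \<Longrightarrow> cf w s - cf w t = k * (s - t) / ((s + r) * (t + r))"
proof -
  have "\<exists>k r. k \<noteq> 0 \<and> 0 \<le> r \<and> r \<le> (1::real) \<and>
    (\<forall>s>0. \<forall>t>0. cf w s - cf w t = k * (s - t) / ((s + r) * (t + r)))"
    using assms
  proof (induction w rule: rev_induct)
    case Nil
    then show ?case by simp
  next
    case (snoc c w)
    have c: "1 \<le> real c" using snoc.prems by auto
    show ?case
    proof (cases "w = []")
      case True
      have "\<forall>s>0. \<forall>t>0. cf (w @ [c]) s - cf (w @ [c]) t = -1 * (s - t) / ((s + 0) * (t + 0))"
        by (auto simp: True field_simps)
      then show ?thesis by (intro exI[of _ "-1"] exI[of _ 0]) auto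
    next
      case False
      then obtain k r where kr: "k \<noteq> 0" "0 \<le> r" "r \<le> 1"
        "\<And>s t. 0 < s \<Longrightarrow> 0 < t \<Longrightarrow> cf w s - cf w t = k * (s - t) / ((s + r) * (t + r))"
        using snoc by auto
      define r' where "r' = 1 / (c + r)"
      define k' where "k' = - k / (c + r)^2"
      have cr: "0 < c + r" using c kr by linarith
      have "cf (w @ [c]) s - cf (w @ [c]) t = k' * (s - t) / ((s + r') * (t + r'))"
        if st: "0 < s" "0 < t" for s t
      proof -
        have p: "0 < c + 1 / s" "0 < c + 1 / t" using st c by (auto intro!: add_pos_pos)
        have e: "c + 1 / x + r = ((c + r) / x) * (x + r')" if "0 < x" for x
        proof -
          have "(c + r) / x * x = c + r" "(c + r) / x * r' = 1 / x"
            using that cr by (simp_all add: r'_def)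
          then show ?thesis by (simp add: distrib_left)
        qed
        have "cf (w @ [c]) s - cf (w @ [c]) t = k * (1 / s - 1 / t) / ((c + 1 / s + r) * (c + 1 / t + r))"
          using kr(4)[OF p] by (simp add: cf_append)
        also have "1 / s - 1 / t = (t - s) / (s * t)" using st by (simp add: field_simps)
        also have "(c + 1 / s + r) * (c + 1 / t + r) = (c + r)^2 / (s * t) * ((s + r') * (t + r'))"
          unfolding e[OF st(1)] e[OF st(2)] by (simp add: power2_eq_square)
        also have "k * ((t - s) / (s * t)) / \<dots> = k' * (s - t) / ((s + r') * (t + r'))"
        proof -
          have "0 < r'" using cr by (simp add: r'_def)
          then show ?thesis using st cr unfolding k'_def
            by (simp add: divide_simps) (simp add: algebra_simps)
        qed
        finally show ?thesis .
      qed
      moreover have "k' \<noteq> 0" "0 \<le> r'" "r' \<le> 1" using kr c cr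
        by (auto simp: k'_def r'_def field_simps)
      ultimately show ?thesis by blast
    qed
  qed
  then show ?thesis using that by blast
qed


text \<open>A node \<open>(w, s, j)\<close> consists of the continuations of \<open>w\<close>, of phase \<open>s\<close>, by a digit at
  least \<open>j\<close>; its gap separates the digit \<open>j\<close> from the larger ones. The order of the endpoints
  depends on the parity of the length of \<open>w\<close>, whence the minima and maxima.\<close>

type_synonym node = "nat list \<times> phase \<times> nat"

fun lo_val :: "nat \<Rightarrow> node \<Rightarrow> real" where
  "lo_val a (w, s, j) = min (cf (a # w) (digit_lo s j)) (cf (a # w) (digit_hi s (max_digit s)))"
fun hi_val :: "nat \<Rightarrow> node \<Rightarrow> real" where
  "hi_val a (w, s, j) = max (cf (a # w) (digit_lo s j)) (cf (a # w) (digit_hi s (max_digit s)))"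
fun gap_lo :: "nat \<Rightarrow> node \<Rightarrow> real" where
  "gap_lo a (w, s, j) = min (cf (a # w) (digit_hi s j)) (cf (a # w) (digit_lo s (Suc j)))"
fun gap_hi :: "nat \<Rightarrow> node \<Rightarrow> real" where
  "gap_hi a (w, s, j) = max (cf (a # w) (digit_hi s j)) (cf (a # w) (digit_lo s (Suc j)))"

definition gap_ratio :: "nat \<Rightarrow> node \<Rightarrow> real" where
  "gap_ratio a n = gap_hi a n / gap_lo a n"
definition len_ratio :: "nat \<Rightarrow> node \<Rightarrow> real" where
  "len_ratio a n = hi_val a n / lo_val a n"

fun phase_after :: "phase \<Rightarrow> nat list \<Rightarrow> phase" where
  "phase_after s [] = s"
| "phase_after s (d # w) = phase_after (next_phase s d) w"

lemma legal_append: "legal s (v @ w) \<longleftrightarrow> legal s v \<and> legal (phase_after s v) w"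
  by (induction v arbitrary: s) auto

lemma phase_after_append: "phase_after s (v @ w) = phase_after (phase_after s v) w"
  by (induction v arbitrary: s) auto

lemma legal_ge1: "legal s w \<Longrightarrow> \<forall>c\<in>set w. 1 \<le> c"
  by (induction w arbitrary: s) auto

lemma two_le_max_digit: "2 \<le> max_digit s" by (cases s) auto

text \<open>The bound 41/40 on the gap ratio is matched to the constant in \<open>thick\<close>:
  together they turn a comparison of lengths into one of ratios.\<close>

fun valid :: "nat \<Rightarrow> node \<Rightarrow> bool" where
  "valid a (w, s, j) \<longleftrightarrow> 4 \<le> a \<and> legal After4 w \<and> phase_after After4 w = s \<and> 1 \<le> j \<and> j < max_digit s
     \<and> gap_hi a (w, s, j) \<le> 41/40 * gap_lo a (w, s, j)"

text \<open>Since \<open>j\<close> is at most 3 in a valid node, the weight 4 makes the depth grow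
  even when a new digit resets \<open>j\<close> to 1.\<close>

fun depth :: "node \<Rightarrow> nat" where "depth (w, s, j) = 4 * length w + j"

section \<open>Splitting a node at its gap\<close>

definition digit_child :: "node \<Rightarrow> nat \<Rightarrow> node" where
  "digit_child n d = (case n of (w, s, j) \<Rightarrow> (w @ [d], next_phase s d, 1))"
text \<open>A single remaining digit is expanded at once, so that every node still has a
  gap.\<close>

definition rest_child :: "node \<Rightarrow> node" where
  "rest_child n = (case n of (w, s, j) \<Rightarrow> if Suc j < max_digit s then (w, s, Suc j) else digit_child n (Suc j))"

lemma cf_Cons_bounds:
  assumes "\<forall>c\<in>set w. 1 \<le> c" "1 \<le> t"
  shows "real a < cf (a # w) t" "cf (a # w) t \<le> real a + 1"
proof -
  have "1 \<le> cf w t" using assms by (rule cf_ge1)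
  then show "real a < cf (a # w) t" "cf (a # w) t \<le> real a + 1" by auto
qed

lemma digit_hi_max_ge1: "1 \<le> digit_hi s (max_digit s)"
  by (cases s) (auto simp: digit_hi_def)

lemma node_bounds:
  assumes "4 \<le> a" "legal After4 w" "1 \<le> j" "j < max_digit s" "n = (w, s, j)"
  shows "real a < lo_val a n" "real a < gap_lo a n" "gap_hi a n \<le> real a + 1"
      "hi_val a n \<le> real a + 1"
proof -
  note e = endpoints_less[OF assms(3,4)]
  have t: "1 \<le> digit_lo s j" "1 \<le> digit_hi s j" "1 \<le> digit_lo s (Suc j)"
      "1 \<le> digit_hi s (max_digit s)" using e by auto
  note c = cf_Cons_bounds[OF legal_ge1[OF assms(2)]]
  show "real a < lo_val a n" "real a < gap_lo a n" "gap_hi a n \<le> real a + 1"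
      "hi_val a n \<le> real a + 1"
    using c t by (simp_all add: assms(5) del: cf.simps)
qed

text \<open>\<open>n1\<close> lies to the left and \<open>n2\<close> to the right of the gap; which
  of them is the digit child depends on the orientation of \<open>cf\<close>. The covering
  conditions are inequalities, since the hull of a digit child may exceed the interval allotted to
  its digit.\<close>

lemma node_split:
  assumes n: "n = (w, s, j)" and a: "4 \<le> a" and w: "legal After4 w"
    and j: "1 \<le> j" "j < max_digit s"
  obtains n1 n2 where "{n1, n2} = {digit_child n j, rest_child n}"
    "lo_val a n1 \<le> lo_val a n" "gap_lo a n \<le> hi_val a n1"
    "lo_val a n2 \<le> gap_hi a n" "hi_val a n \<le> hi_val a n2"
    "gap_lo a n < gap_hi a n"
    "41/40 * (gap_hi a n - gap_lo a n) \<le> gap_lo a n - lo_val a n"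
    "41/40 * (gap_hi a n - gap_lo a n) \<le> hi_val a n - gap_hi a n"
    "\<And>m. m \<in> {n1, n2} \<Longrightarrow> gap_hi a m - gap_lo a m \<le> 3/4 * (gap_hi a n - gap_lo a n)"
proof -
  define v where "v = a # w"
  have v: "\<forall>c\<in>set v. 1 \<le> c" "v \<noteq> []" using a legal_ge1[OF w]
    by (auto simp: v_def)
  obtain k r where kr: "k \<noteq> 0" "0 \<le> r" "r \<le> (1::real)"
    and diff: "\<And>s t. 0 < s \<Longrightarrow> 0 < t \<Longrightarrow> cf v s - cf v t = k * (s - t) / ((s + r) * (t + r))"
    using cf_diff[OF v] by metis
  \<comment> \<open>Before the map \<open>cf v\<close>, the digit \<open>j\<close> occupies
    \<open>t0\<close> to \<open>t1\<close>, the gap \<open>t1\<close> to \<open>t2\<close>, and the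
    larger digits \<open>t2\<close> to \<open>t3\<close>.\<close>
  define t0 t1 t2 t3 where t_def: "t0 = digit_lo s j" "t1 = digit_hi s j"
      "t2 = digit_lo s (Suc j)" "t3 = digit_hi s (max_digit s)"
  have t: "1 \<le> t0" "t0 < t1" "t1 < t2" "t2 < t3" using endpoints_less[OF j]
    by (auto simp: t_def)
  have pos: "0 < t0 + r" "0 < t1 + r" "0 < t2 + r" "0 < t3 + r" using t kr by auto
  have adiff: "\<bar>cf v x - cf v y\<bar> = \<bar>k\<bar> * (\<bar>x - y\<bar> / ((x + r) * (y + r)))" if "0 < x" "0 < y" for x y
    using diff[OF that] that kr by (simp add: abs_mult)
  have mono: "if 0 < k then cf v x \<le> cf v y else cf v y \<le> cf v x"
    if "0 < x" "x \<le> y" for x y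
  proof -
    have "cf v y - cf v x = k * ((y - x) / ((y + r) * (x + r)))" using diff[of y x] that by simp
    moreover have "0 \<le> (y - x) / ((y + r) * (x + r))" using that kr by simp
    ultimately have "0 < k \<Longrightarrow> 0 \<le> cf v y - cf v x" "k \<le> 0 \<Longrightarrow> cf v y - cf v x \<le> 0"
      by (simp_all only: mult_nonneg_nonneg[OF less_imp_le] mult_nonpos_nonneg)
    then show ?thesis by simp
  qed
  have smono: "if 0 < k then cf v x < cf v y else cf v y < cf v x" if "0 < x" "x < y" for x y
  proof -
    have "cf v y \<noteq> cf v x" using diff[of y x] that kr by auto
    then show ?thesis using mono[of x y] that by (auto split: if_splits)
  qed
  let ?G = "(t2 - t1) / ((t2 + r) * (t1 + r))"
  have G: "gap_hi a n - gap_lo a n = \<bar>k\<bar> * ?G"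
    using adiff[of t2 t1] t by (simp add: n v_def[symmetric] t_def[symmetric] del: cf.simps)
  have b1: "41/40 * ?G \<le> (t1 - t0) / ((t1 + r) * (t0 + r))"
  proof -
    have "41/40 * ((t2 - t1) * (t0 + r)) \<le> (t1 - t0) * (t2 + r)"
      using thick(1)[OF j kr(2,3)] by (simp only: t_def)
    then have "41/40 * ((t2 - t1) * (t0 + r)) / ((t2 + r) * (t1 + r) * (t0 + r))
        \<le> (t1 - t0) * (t2 + r) / ((t2 + r) * (t1 + r) * (t0 + r))"
      using pos by (intro divide_right_mono) auto
    then show ?thesis using pos by (simp add: mult.assoc)
  qed
  have b2: "41/40 * ?G \<le> (t3 - t2) / ((t3 + r) * (t2 + r))"
  proof -
    have "41/40 * ((t2 - t1) * (t3 + r)) \<le> (t3 - t2) * (t1 + r)"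
      using thick(2)[OF j kr(2,3)] by (simp only: t_def)
    then have "41/40 * ((t2 - t1) * (t3 + r)) / ((t2 + r) * (t1 + r) * (t3 + r))
        \<le> (t3 - t2) * (t1 + r) / ((t2 + r) * (t1 + r) * (t3 + r))"
      using pos by (intro divide_right_mono) auto
    also have "41/40 * ((t2 - t1) * (t3 + r)) / ((t2 + r) * (t1 + r) * (t3 + r)) = 41/40 * ?G"
      using pos by simp
    also have "(t3 - t2) * (t1 + r) / ((t2 + r) * (t1 + r) * (t3 + r)) = (t3 - t2) / ((t3 + r) * (t2 + r))"
      using pos by (simp add: mult.commute)
    finally show ?thesis .
  qed
  have B1: "41/40 * (gap_hi a n - gap_lo a n) \<le> \<bar>cf v t1 - cf v t0\<bar>"
    using mult_left_mono[OF b1, of "\<bar>k\<bar>"] adiff[of t1 t0] t unfolding G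
    by (simp add: mult_ac)
  have B2: "41/40 * (gap_hi a n - gap_lo a n) \<le> \<bar>cf v t3 - cf v t2\<bar>"
    using mult_left_mono[OF b2, of "\<bar>k\<bar>"] adiff[of t3 t2] t unfolding G
    by (simp add: mult_ac)
  \<comment> \<open>By \<open>tail_cover\<close>, expanding a tail by one more digit gives an
    interval containing the prescribed one.\<close>
  have digit_cover: "lo_val a (digit_child n d) \<le> min (cf v (digit_lo s d)) (cf v (digit_hi s d))"
    "max (cf v (digit_lo s d)) (cf v (digit_hi s d)) \<le> hi_val a (digit_child n d)"
      if d: "1 \<le> d" for d
  proof -
    let ?s = "next_phase s d"
    have x: "0 < digit_lo ?s 1" "0 < digit_hi ?s (max_digit ?s)"
      using endpoints_less[of 1 ?s] two_le_max_digit[of ?s] by auto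
    have "0 < d + 1 / digit_hi ?s (max_digit ?s)" using x by (intro add_nonneg_pos) auto
    moreover have "d + 1 / digit_hi ?s (max_digit ?s) \<le> digit_lo s d"
      using tail_cover(1)[of ?s] by (simp add: digit_lo_def)
    moreover have "digit_hi s d \<le> d + 1 / digit_lo ?s 1" using tail_cover(2)[of ?s]
      by (simp add: digit_hi_def)
    moreover have "digit_lo s d \<le> digit_hi s d" "0 < digit_lo s d" using d
      by (cases s; auto simp: digit_lo_def digit_hi_def add_nonneg_pos)+
    ultimately have "if 0 < k then cf v (d + 1 / digit_hi ?s (max_digit ?s)) \<le> cf v (digit_lo s d)
        \<and> cf v (digit_lo s d) \<le> cf v (digit_hi s d) \<and> cf v (digit_hi s d)
        \<le> cf v (d + 1 / digit_lo ?s 1)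
       else cf v (d + 1 / digit_hi ?s (max_digit ?s)) \<ge> cf v (digit_lo s d)
           \<and> cf v (digit_lo s d) \<ge> cf v (digit_hi s d)
           \<and> cf v (digit_hi s d) \<ge> cf v (d + 1 / digit_lo ?s 1)"
      using mono[of "d + 1 / digit_hi ?s (max_digit ?s)" "digit_lo s d"] mono[of "digit_lo s d"
          "digit_hi s d"] mono[of "digit_hi s d" "d + 1 / digit_lo ?s 1"] by auto
    moreover have "cf (a # w @ [d]) x = cf v (d + 1 / x)" for x
      using cf_append[of v "[d]" x] by (simp add: v_def)
    ultimately show "lo_val a (digit_child n d) \<le> min (cf v (digit_lo s d)) (cf v (digit_hi s d))"
      "max (cf v (digit_lo s d)) (cf v (digit_hi s d)) \<le> hi_val a (digit_child n d)"
      by (auto simp: n digit_child_def simp del: cf.simps split: if_splits)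
  qed
  have rest_cover: "lo_val a (rest_child n) \<le> min (cf v t2) (cf v t3)"
      "max (cf v t2) (cf v t3) \<le> hi_val a (rest_child n)"
  proof (atomize(full), cases "Suc j < max_digit s")
    case True
    then show "lo_val a (rest_child n) \<le> min (cf v t2) (cf v t3) \<and> max (cf v t2) (cf v t3)
        \<le> hi_val a (rest_child n)"
      by (simp add: n rest_child_def v_def t_def del: cf.simps)
  next
    case False
    then have "max_digit s = Suc j" using j by simp
    then show "lo_val a (rest_child n) \<le> min (cf v t2) (cf v t3) \<and> max (cf v t2) (cf v t3)
        \<le> hi_val a (rest_child n)"
      using digit_cover[of "Suc j"] by (simp add: rest_child_def n t_def del: cf.simps)
  qed
  have digit_gap: "gap_hi a (digit_child n d) - gap_lo a (digit_child n d)
      \<le> 3/4 * (gap_hi a n - gap_lo a n)"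
    if d: "d = j \<or> d = Suc j" for d
  proof -
    let ?s = "next_phase s d"
    define y1 y2 where y_def: "y1 = digit_hi ?s 1" "y2 = digit_lo ?s 2"
    have y: "1 \<le> y1" "y1 < y2" using endpoints_less[of 1 ?s] two_le_max_digit[of ?s]
      by (auto simp: y_def numeral_2_eq_2)
    have d1: "1 \<le> real d" using d j by auto
    have p: "0 < d + 1 / y1" "0 < d + 1 / y2" using y d1 by (auto intro!: add_pos_pos)
    have q: "0 < (d + r) * y1 + 1" "0 < (d + r) * y2 + 1" using y d1 kr
      by (auto intro!: add_nonneg_pos)
    have "cf (a # w @ [d]) x = cf v (d + 1 / x)" for x
      using cf_append[of v "[d]" x] by (simp add: v_def)
    then have "gap_hi a (digit_child n d) - gap_lo a (digit_child n d) = \<bar>cf v (d + 1 / y1) - cf v (d + 1 / y2)\<bar>"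
      by (simp add: n digit_child_def y_def numeral_2_eq_2 del: cf.simps)
    also have "\<dots> = \<bar>k\<bar> * ((1 / y1 - 1 / y2) / ((d + 1 / y1 + r) * (d + 1 / y2 + r)))"
      using y by (subst adiff[OF p]) (simp add: frac_le)
    also have "(1 / y1 - 1 / y2) / ((d + 1 / y1 + r) * (d + 1 / y2 + r)) = (y2 - y1) / (((d + r) * y1 + 1) * ((d + r) * y2 + 1))"
    proof -
      have "d + 1 / y1 + r = ((d + r) * y1 + 1) / y1" "d + 1 / y2 + r = ((d + r) * y2 + 1) / y2"
        "1 / y1 - 1 / y2 = (y2 - y1) / (y1 * y2)"
        using y by (auto simp: field_simps)
      then show ?thesis using y by simp
    qed
    also have "\<dots> \<le> 3/4 * ?G"
    proof -
      have
          "(y2 - y1) * ((t1 + r) * (t2 + r)) \<le> 3/4 * (t2 - t1) * (((d + r) * y1 + 1) * ((d + r) * y2 + 1))"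
        using gap_digit[OF j d kr(2,3)] by (simp only: t_def y_def)
      then show ?thesis using pos q by (simp add: divide_simps) (simp add: algebra_simps)
    qed
    finally show ?thesis using mult_left_mono[of _ _ "\<bar>k\<bar>"] unfolding G
      by (simp add: mult_left_mono mult_ac)
  qed
  have rest_gap: "gap_hi a (rest_child n) - gap_lo a (rest_child n)
      \<le> 3/4 * (gap_hi a n - gap_lo a n)"
  proof (cases "Suc j < max_digit s")
    case True
    define y1 y2 where y_def: "y1 = digit_hi s (Suc j)" "y2 = digit_lo s (Suc (Suc j))"
    have y: "1 \<le> y1" "y1 < y2" using endpoints_less[of "Suc j" s] True by (auto simp: y_def)
    have "gap_hi a (rest_child n) - gap_lo a (rest_child n) = \<bar>cf v y2 - cf v y1\<bar>"
      using True by (simp add: n rest_child_def y_def v_def del: cf.simps)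
    also have "\<dots> = \<bar>k\<bar> * ((y2 - y1) / ((y2 + r) * (y1 + r)))"
      using adiff[of y2 y1] y by simp
    also have "\<dots> \<le> \<bar>k\<bar> * (3/4 * ?G)"
    proof (rule mult_left_mono)
      have "(y2 - y1) * ((t1 + r) * (t2 + r)) \<le> 3/4 * (t2 - t1) * ((y1 + r) * (y2 + r))"
        using gap_rest[OF j(1) True kr(2,3)] by (simp only: t_def y_def)
      then show "(y2 - y1) / ((y2 + r) * (y1 + r)) \<le> 3/4 * ?G"
        using pos y kr by (simp add: divide_simps) (simp add: algebra_simps)
    qed simp
    finally show ?thesis unfolding G by (simp only: mult.left_commute[of "\<bar>k\<bar>"])
  next
    case False
    then show ?thesis using digit_gap[of "Suc j"] by (simp add: rest_child_def n)
  qed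
  show ?thesis
  proof (cases "0 < k")
    case True
    have ord: "cf v t0 < cf v t1" "cf v t1 < cf v t2" "cf v t2 < cf v t3" using smono t True by auto
    have "lo_val a n = cf v t0" "gap_lo a n = cf v t1" "gap_hi a n = cf v t2" "hi_val a n = cf v t3"
      using ord by (auto simp: n v_def[symmetric] t_def[symmetric] simp del: cf.simps)
    then show ?thesis
      using ord B1 B2 digit_cover[OF j(1)] rest_cover digit_gap[of j] rest_gap
      by (intro that[of "digit_child n j" "rest_child n"]) (auto simp: t_def[symmetric])
  next
    case False
    have ord: "cf v t0 > cf v t1" "cf v t1 > cf v t2" "cf v t2 > cf v t3" using smono t False
      by auto
    have "lo_val a n = cf v t3" "gap_lo a n = cf v t2" "gap_hi a n = cf v t1" "hi_val a n = cf v t0"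
      using ord by (auto simp: n v_def[symmetric] t_def[symmetric] simp del: cf.simps)
    then show ?thesis
      using ord B1 B2 digit_cover[OF j(1)] rest_cover digit_gap[of j] rest_gap
      by (intro that[of "rest_child n" "digit_child n j"]) (auto simp: t_def[symmetric])
  qed
qed


lemma valid_gap_ratio:
  assumes "valid a n"
  shows "1 < gap_ratio a n" "0 < lo_val a n" "0 < gap_lo a n" "0 < gap_hi a n" "0 < hi_val a n"
proof -
  obtain w s j where n: "n = (w, s, j)" by (cases n) auto
  have v: "4 \<le> a" "legal After4 w" "1 \<le> j" "j < max_digit s" using assms by (auto simp: n)
  have b: "0 < lo_val a n" "0 < gap_lo a n" using node_bounds[OF v n] by auto
  obtain n1 n2 where "gap_lo a n < gap_hi a n"
    "41/40 * (gap_hi a n - gap_lo a n) \<le> hi_val a n - gap_hi a n"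
    using node_split[OF n v] by metis
  with b show "1 < gap_ratio a n" "0 < lo_val a n" "0 < gap_lo a n" "0 < gap_hi a n"
      "0 < hi_val a n"
    by (auto simp: gap_ratio_def)
qed

text \<open>Both children are at least as long as the gap also in logarithmic scale, and
  \<open>gap_ratio - 1\<close> shrinks by the factor 15/16. The latter is 3/4 divided by 4/5, since
  all values lie between \<open>a\<close> and \<open>a + 1\<close> with
  \<open>a \<ge> 4\<close>.\<close>

lemma valid_split:
  assumes "valid a n"
  obtains n1 n2 where "valid a n1" "valid a n2" "depth n < depth n1" "depth n < depth n2"
    "lo_val a n1 \<le> lo_val a n" "gap_lo a n \<le> hi_val a n1"
    "lo_val a n2 \<le> gap_hi a n" "hi_val a n \<le> hi_val a n2"
    "gap_ratio a n \<le> len_ratio a n1" "gap_ratio a n \<le> len_ratio a n2"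
    "gap_ratio a n1 - 1 \<le> 15/16 * (gap_ratio a n - 1)"
        "gap_ratio a n2 - 1 \<le> 15/16 * (gap_ratio a n - 1)"
proof -
  obtain w s j where n: "n = (w, s, j)" by (cases n) auto
  have v: "4 \<le> a" "legal After4 w" "1 \<le> j" "j < max_digit s"
    and s: "phase_after After4 w = s"
    and small: "gap_hi a n \<le> 41/40 * gap_lo a n" using assms by (auto simp: n)
  note b = node_bounds[OF v n]
  have a4: "4 \<le> real a" using v by simp
  obtain n1 n2 where c: "{n1, n2} = {digit_child n j, rest_child n}"
    and cover: "lo_val a n1 \<le> lo_val a n" "gap_lo a n \<le> hi_val a n1"
      "lo_val a n2 \<le> gap_hi a n" "hi_val a n \<le> hi_val a n2"
    and less: "gap_lo a n < gap_hi a n"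
    and thick: "41/40 * (gap_hi a n - gap_lo a n) \<le> gap_lo a n - lo_val a n"
      "41/40 * (gap_hi a n - gap_lo a n) \<le> hi_val a n - gap_hi a n"
    and gap: "\<And>m. m \<in> {n1, n2} \<Longrightarrow> gap_hi a m - gap_lo a m \<le> 3/4 * (gap_hi a n - gap_lo a n)"
    using node_split[OF n v] by metis
  have child: "valid a m" "depth n < depth m" "gap_ratio a m - 1 \<le> 15/16 * (gap_ratio a n - 1)"
    if m: "m \<in> {n1, n2}" for m
  proof -
    obtain w' s' j' where m': "m = (w', s', j')" by (cases m) auto
    have m2: "m = digit_child n j \<or> m = rest_child n" using m unfolding c by auto
    have pre: "legal After4 w' \<and> phase_after After4 w' = s' \<and> 1 \<le> j' \<and> j' < max_digit s'
        \<and> depth n < depth m"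
    proof -
      have "1 < max_digit t" for t using two_le_max_digit[of t] by simp
      moreover have "j < 4" using v by (cases s) auto
      ultimately show ?thesis using m2 v s unfolding n m'
        by (auto simp: digit_child_def rest_child_def legal_append phase_after_append simp del: next_phase.simps
            split: if_splits)
    qed
    have mb: "real a < gap_lo a m" using node_bounds[of a w' j' s' m] pre v m' by auto
    have B: "gap_lo a n \<le> 5/4 * gap_lo a m" using b less mb a4 by linarith
    have d: "gap_hi a m - gap_lo a m \<le> 3/4 * (gap_hi a n - gap_lo a n)" using gap[OF m] .
    \<comment> \<open>The relative gap is at most \<open>3/4 * 5/4 * 1/40\<close>, which is below
      1/40.\<close>
    have "gap_hi a m \<le> 41/40 * gap_lo a m" using d small B mb a4 by argo
    then show "valid a m" using pre v by (simp add: m')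
    show "depth n < depth m" using pre by simp
    have "gap_ratio a m - 1 = (gap_hi a m - gap_lo a m) / gap_lo a m"
      using mb a4 by (simp add: gap_ratio_def field_simps)
    also have "\<dots> \<le> (3/4 * (gap_hi a n - gap_lo a n)) / gap_lo a m"
      using d mb a4 by (intro divide_right_mono) auto
    also have "\<dots> \<le> (3/4 * (gap_hi a n - gap_lo a n)) / (4/5 * gap_lo a n)"
      using B less b a4 by (intro divide_left_mono) auto
    also have "\<dots> = 15/16 * (gap_ratio a n - 1)"
      using b a4 by (simp add: gap_ratio_def field_simps)
    finally show "gap_ratio a m - 1 \<le> 15/16 * (gap_ratio a n - 1)" .
  qed
  let ?A = "lo_val a n" and ?B = "gap_lo a n" and ?C = "gap_hi a n" and ?D = "hi_val a n"
  have pos: "0 < ?A" "0 < ?B" "0 < ?C" "0 < ?D" using valid_gap_ratio[OF assms] by auto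
  have posc: "0 < lo_val a n1" "0 < lo_val a n2"
    using child[of n1] child[of n2] valid_gap_ratio by auto
  \<comment> \<open>On the left, equal lengths suffice: the bridge lies nearer to 0 than the gap and
    so has the larger ratio.\<close>
  have "?C * ?A \<le> ?C * (?B - (?C - ?B))" using thick(1) less pos by (intro mult_left_mono) auto
  also have "\<dots> \<le> ?B * ?B" using zero_le_square[of "?C - ?B"] by (simp add: algebra_simps)
  finally have "?C / ?B \<le> ?B / ?A" using pos by (simp add: field_simps)
  also have "?B / ?A \<le> hi_val a n1 / lo_val a n1" using cover pos posc by (intro frac_le) auto
  finally have len1: "gap_ratio a n \<le> len_ratio a n1" by (simp add: gap_ratio_def len_ratio_def)
  \<comment> \<open>On the right the bridge must exceed the gap by the factor
    \<open>?C / ?B\<close>, which is at most 41/40 by validity.\<close>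
  have "?C * (?C - ?B) \<le> 41/40 * ?B * (?C - ?B)" using small less
    by (intro mult_right_mono) auto
  also have "\<dots> = ?B * (41/40 * (?C - ?B))" by simp
  also have "\<dots> \<le> ?B * (?D - ?C)" using thick(2) pos by (intro mult_left_mono) auto
  finally have "?C / ?B \<le> ?D / ?C" using pos by (simp add: field_simps)
  also have "?D / ?C \<le> hi_val a n2 / lo_val a n2" using cover pos posc by (intro frac_le) auto
  finally have len2: "gap_ratio a n \<le> len_ratio a n2" by (simp add: gap_ratio_def len_ratio_def)
  show ?thesis using that[of n1 n2] child cover len1 len2 by blast
qed

text \<open>In logarithms: the target lies in the sum of two intervals, and the gap of each is no
  longer than the other interval. This is the invariant of the gap lemma.\<close>

definition paired :: "nat \<Rightarrow> nat \<Rightarrow> real \<Rightarrow> node \<Rightarrow> node \<Rightarrow> bool" where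
  "paired a b M n m \<longleftrightarrow> valid a n \<and> valid b m
     \<and> lo_val a n * lo_val b m \<le> M \<and> M \<le> hi_val a n * hi_val b m
     \<and> gap_ratio a n \<le> len_ratio b m \<and> gap_ratio b m \<le> len_ratio a n"

lemma paired_sym: "paired a b M n m \<longleftrightarrow> paired b a M m n"
  by (auto simp: paired_def mult.commute)

text \<open>Splitting the node with the larger gap keeps both gaps bridged by the other node.\<close>

lemma paired_step:
  assumes p: "paired a b M n m" and le: "gap_ratio b m \<le> gap_ratio a n"
  obtains n' where "paired a b M n' m" "depth n < depth n'"
    "gap_ratio a n' - 1 \<le> 15/16 * (gap_ratio a n - 1)"
proof -
  have v: "valid a n" "valid b m" using p by (auto simp: paired_def)
  note pn = valid_gap_ratio[OF v(1)] and pm = valid_gap_ratio[OF v(2)]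
  obtain n1 n2 where c: "valid a n1" "valid a n2" "depth n < depth n1" "depth n < depth n2"
    "lo_val a n1 \<le> lo_val a n" "gap_lo a n \<le> hi_val a n1"
    "lo_val a n2 \<le> gap_hi a n" "hi_val a n \<le> hi_val a n2"
    "gap_ratio a n \<le> len_ratio a n1" "gap_ratio a n \<le> len_ratio a n2"
    "gap_ratio a n1 - 1 \<le> 15/16 * (gap_ratio a n - 1)"
        "gap_ratio a n2 - 1 \<le> 15/16 * (gap_ratio a n - 1)"
    using valid_split[OF v(1)] by metis
  \<comment> \<open>Hence the products with the part left of the gap and those with the part right
    of it leave no hole between them, and \<open>M\<close> falls to one of the two children.\<close>
  have bridge: "gap_hi a n * lo_val b m \<le> gap_lo a n * hi_val b m"
    using p pn pm by (simp add: paired_def gap_ratio_def len_ratio_def field_simps)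
  show ?thesis
  proof (cases "M \<le> hi_val a n1 * hi_val b m")
    case True
    have "lo_val a n1 * lo_val b m \<le> lo_val a n * lo_val b m" using c pm
      by (intro mult_right_mono) auto
    with True have "paired a b M n1 m" using p c le pn by (auto simp: paired_def)
    then show ?thesis using that c by blast
  next
    case False
    have "lo_val a n2 * lo_val b m \<le> gap_hi a n * lo_val b m" using c pm
      by (intro mult_right_mono) auto
    also note bridge
    also have "gap_lo a n * hi_val b m \<le> hi_val a n1 * hi_val b m" using c pm
      by (intro mult_right_mono) auto
    finally have "lo_val a n2 * lo_val b m \<le> M" using False by simp
    moreover have "hi_val a n * hi_val b m \<le> hi_val a n2 * hi_val b m" using c pm
      by (intro mult_right_mono) auto
    ultimately have "paired a b M n2 m" using p c le pn by (auto simp: paired_def)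
    then show ?thesis using that c by blast
  qed
qed

text \<open>Gaps shrink geometrically, so a node cannot escape being split for ever.\<close>

lemma paired_deepen:
  assumes "paired a b M n m"
  obtains n' m' where "paired a b M n' m'" "depth n < depth n'" "depth m \<le> depth m'"
proof -
  \<comment> \<open>Here \<open>i\<close> bounds the number of splittings of \<open>m\<close> that
    may precede the splitting of \<open>n\<close>.\<close>
  have "\<exists>n' m'. paired a b M n' m' \<and> depth n < depth n' \<and> depth m \<le> depth m'"
    if "paired a b M n m" "(15/16) ^ i * (gap_ratio b m - 1) \<le> gap_ratio a n - 1" for i
    using that
  proof (induction i arbitrary: m)
    case 0
    then have "gap_ratio b m \<le> gap_ratio a n" by simp
    then show ?case using 0(1) by (metis paired_step order_refl)
  next
    case (Suc i)
    show ?case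
    proof (cases "gap_ratio b m \<le> gap_ratio a n")
      case True
      then show ?thesis using Suc.prems(1) by (metis paired_step order_refl)
    next
      case False
      then have "paired b a M m n" "gap_ratio a n \<le> gap_ratio b m" using Suc.prems
        by (auto simp: paired_sym)
      then obtain m' where m': "paired b a M m' n" "depth m < depth m'"
        "gap_ratio b m' - 1 \<le> 15/16 * (gap_ratio b m - 1)"
        by (rule paired_step)
      have "(15/16) ^ i * (gap_ratio b m' - 1) \<le> (15/16) ^ i * (15/16 * (gap_ratio b m - 1))"
        using m' by (intro mult_left_mono) auto
      also have "\<dots> = (15/16) ^ Suc i * (gap_ratio b m - 1)" by simp
      also have "\<dots> \<le> gap_ratio a n - 1" by (rule Suc.prems(2))
      finally have "\<exists>n' m''. paired a b M n' m'' \<and> depth n < depth n' \<and> depth m' \<le> depth m''"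
        using Suc.IH m' by (simp add: paired_sym)
      then show ?thesis using m'(2) by (meson less_imp_le le_trans)
    qed
  qed
  moreover have "\<exists>i. (15/16) ^ i * (gap_ratio b m - 1) \<le> gap_ratio a n - 1"
  proof -
    have pos: "0 < gap_ratio b m - 1" "0 < gap_ratio a n - 1"
      using assms valid_gap_ratio by (auto simp: paired_def)
    then obtain i where "(15/16) ^ i < (gap_ratio a n - 1) / (gap_ratio b m - 1)"
      using real_arch_pow_inv[of "(gap_ratio a n - 1) / (gap_ratio b m - 1)" "15/16"] by auto
    then show ?thesis using pos by (intro exI[of _ i]) (simp add: field_simps)
  qed
  ultimately show ?thesis using assms that by blast
qed

lemma paired_deep:
  assumes "paired a b M n m"
  shows "\<exists>n' m'. paired a b M n' m' \<and> K \<le> depth n' \<and> K \<le> depth m'"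
proof (induction K)
  case 0
  show ?case using assms by blast
next
  case (Suc K)
  then obtain n1 m1 where 1: "paired a b M n1 m1" "K \<le> depth n1" "K \<le> depth m1" by blast
  then obtain n2 m2 where 2: "paired a b M n2 m2" "depth n1 < depth n2" "depth m1 \<le> depth m2"
    using paired_deepen by metis
  then obtain n3 m3 where "paired b a M m3 n3" "depth m2 < depth m3" "depth n2 \<le> depth n3"
    using paired_deepen[of b a M m2 n2] paired_sym by metis
  then have "paired a b M n3 m3 \<and> Suc K \<le> depth n3 \<and> Suc K \<le> depth m3"
    using 1 2 by (auto simp: paired_sym)
  then show ?case by blast
qed

section \<open>Realising prescribed products\<close>

lemma paired_root:
  assumes ab: "4 \<le> a" "b = a \<or> b = Suc a"
    and M: "(a + 33/125) * (b + 33/125) \<le> M" "M \<le> (a + 207/250) * (b + 207/250)"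
  shows "paired a b M ([], After4, 1) ([], After4, 1)"
proof -
  let ?n = "([], After4, 1) :: node"
  \<comment> \<open>These are the reciprocals of the endpoints 3.7928, 2.2072, 1.7928 and 1.2072 of
    the node for phase \<open>After4\<close>. The constants 33/125 and 207/250 of the statement are
    \<open>p0\<close> and \<open>p3\<close> rounded inwards.\<close>
  define p0 p1 p2 p3 :: real where p_def: "p0 = 10000/37928" "p1 = 10000/22072" "p2 = 10000/17928"
      "p3 = 10000/12072"
  have vals: "lo_val c ?n = c + p0" "gap_lo c ?n = c + p1" "gap_hi c ?n = c + p2"
      "hi_val c ?n = c + p3"
    for c by (simp_all add: digit_lo_def digit_hi_def p_def)
  have A: "4 \<le> real a" "real b = real a \<or> real b = real a + 1" using ab by auto
  have g: "valid c ?n" if "4 \<le> c" for c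
  proof -
    have "gap_hi c ?n \<le> 41/40 * gap_lo c ?n" unfolding vals using that by (simp add: p_def)
    then show ?thesis using that by (simp del: gap_hi.simps gap_lo.simps)
  qed
  have r: "gap_ratio c ?n \<le> len_ratio d ?n"
    if "4 \<le> real c" "real d \<le> real c + 1" for c d
  proof -
    have "gap_ratio c ?n = 1 + (p2 - p1) / (c + p1)"
      unfolding gap_ratio_def vals using that by (simp add: p_def field_simps)
    also have "\<dots> \<le> 1 + (p3 - p0) / (d + p0)"
    proof -
      have "(p2 - p1) * (d + p0) \<le> (p2 - p1) * (2 * (c + p1))" using that
        by (intro mult_left_mono) (auto simp: p_def)
      also have "\<dots> \<le> (p3 - p0) * (c + p1)" using that by (simp add: p_def)
      finally have le: "(p2 - p1) * (d + p0) \<le> (p3 - p0) * (c + p1)" .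
      have pos: "0 < c + p1" "0 < d + p0" by (auto simp: p_def intro: add_nonneg_pos)
      have "(p2 - p1) / (c + p1) \<le> (p3 - p0) / (d + p0)"
        unfolding pos_divide_le_eq[OF pos(1)] times_divide_eq_left pos_le_divide_eq[OF pos(2)]
        by (rule le)
      then show ?thesis by simp
    qed
    also have "\<dots> = len_ratio d ?n"
      unfolding len_ratio_def vals using that by (simp add: p_def field_simps)
    finally show ?thesis .
  qed
  have box: "lo_val a ?n * lo_val b ?n \<le> (a + 33/125) * (b + 33/125)"
      "(a + 207/250) * (b + 207/250) \<le> hi_val a ?n * hi_val b ?n"
    unfolding vals by (intro mult_mono; simp add: p_def)+
  have "4 \<le> b" using ab by auto
  then have "valid a ?n" "valid b ?n" using g ab(1) by blast+
  moreover have "gap_ratio a ?n \<le> len_ratio b ?n" "gap_ratio b ?n \<le> len_ratio a ?n"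
    by (rule r; use A in linarith)+
  ultimately show ?thesis unfolding paired_def
    using order_trans[OF box(1) M(1)] order_trans[OF M(2) box(2)] by blast
qed

text \<open>Deep paired nodes have long words, and by \<open>cf_contract\<close> every continuation
  of these stays close to the endpoints of the hulls, whose products enclose \<open>M\<close>.
  Finite words with an error bound thus replace the points of the Cantor sets.\<close>

lemma product_words:
  assumes ab: "4 \<le> a" "b = a \<or> b = Suc a"
    and M: "(a + 33/125) * (b + 33/125) \<le> M" "M \<le> (a + 207/250) * (b + 207/250)"
  obtains u v where "legal After4 u" "legal After4 v" "K \<le> length u" "K \<le> length v"
    "\<And>s t. 1 \<le> s \<Longrightarrow> 1 \<le> t \<Longrightarrow> \<bar>cf (a # u) s * cf (b # v) t - M\<bar>
        \<le> (real a + real b + 6) * (4 * (1/2) ^ K)"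
proof -
  obtain n m where nm: "paired a b M n m" "4 * K + 4 \<le> depth n" "4 * K + 4 \<le> depth m"
    using paired_deep[OF paired_root[OF assms]] by blast
  obtain u s j where n: "n = (u, s, j)" by (cases n) auto
  obtain v s' j' where m: "m = (v, s', j')" by (cases m) auto
  have nv: "legal After4 u" "1 \<le> j" "j < max_digit s"
    and mv: "legal After4 v" "1 \<le> j'" "j' < max_digit s'"
    and b4: "4 \<le> b" using nm by (auto simp: paired_def n m)
  have "j < 4" "j' < 4" using nv(3) mv(3) by (cases s; cases s'; simp)+
  then have len: "K \<le> length u" "K \<le> length v" using nm by (auto simp: n m)
  define e :: real where "e = 4 * (1/2) ^ K"
  have e: "0 < e" "e \<le> 4" by (auto simp: e_def power_le_one)
  have near: "cf (c # w) x - e \<le> cf (c # w) y"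
    if "K \<le> length w" "legal After4 w" "1 \<le> x" "1 \<le> y" "4 \<le> c"
    for c w x y
  proof -
    have "\<bar>cf (c # w) x - cf (c # w) y\<bar> \<le> 4 * (1/2) ^ length (c # w)"
      using that legal_ge1[OF that(2)] by (intro cf_contract) auto
    also have "\<dots> \<le> e" unfolding e_def using that(1)
      by (intro mult_left_mono power_decreasing) auto
    finally show ?thesis by linarith
  qed
  have t: "1 \<le> digit_lo s j" "1 \<le> digit_hi s (max_digit s)" "1 \<le> digit_lo s' j'"
      "1 \<le> digit_hi s' (max_digit s')"
    using endpoints_less nv mv digit_hi_max_ge1 by auto
  have "\<bar>cf (a # u) x * cf (b # v) y - M\<bar> \<le> (real a + real b + 6) * e"
    if xy: "1 \<le> x" "1 \<le> y" for x y
  proof -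
    let ?X = "cf (a # u) x" and ?Y = "cf (b # v) y"
    have X: "a < ?X" "?X \<le> a + 1" and Y: "b < ?Y" "?Y \<le> b + 1"
      using cf_Cons_bounds[OF legal_ge1[OF nv(1)] xy(1)] cf_Cons_bounds[OF legal_ge1[OF mv(1)] xy(2)] by auto
    have up: "?X \<le> lo_val a n + e" "?Y \<le> lo_val b m + e"
      and dn: "hi_val a n \<le> ?X + e" "hi_val b m \<le> ?Y + e"
      using near[of u x _ a] near[of u _ x a] near[of v y _ b] near[of v _ y b] len nv mv t xy ab b4
      by (auto simp: n m diff_le_eq min_def max_def simp del: cf.simps)
    have nb: "a < lo_val a n" "b < lo_val b m" "lo_val a n \<le> a + 1" "lo_val b m \<le> b + 1"
        "0 < hi_val a n" "0 < hi_val b m"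
    proof -
      show "a < lo_val a n" using node_bounds[OF ab(1) nv n] by simp
      show "b < lo_val b m" using node_bounds[OF b4 mv m] by simp
      show "lo_val a n \<le> a + 1" using cf_Cons_bounds[OF legal_ge1[OF nv(1)] t(1), of a]
        by (simp add: n del: cf.simps)
      show "lo_val b m \<le> b + 1" using cf_Cons_bounds[OF legal_ge1[OF mv(1)] t(3), of b]
        by (simp add: m del: cf.simps)
      show "0 < hi_val a n" "0 < hi_val b m" using nm(1) valid_gap_ratio by (auto simp: paired_def)
    qed
    have "?X * ?Y \<le> (lo_val a n + e) * (lo_val b m + e)" using up X Y e nb
      by (intro mult_mono) auto
    also have "\<dots> = lo_val a n * lo_val b m + e * (lo_val a n + lo_val b m + e)"
      by (simp add: algebra_simps)
    \<comment> \<open>The lower endpoints are at most \<open>a + 1\<close> and \<open>b + 1\<close>,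
      and \<open>e\<close> is at most 4.\<close>
    also have "\<dots> \<le> M + e * (a + b + 6)"
      using nm(1) nb e by (intro add_mono mult_left_mono) (auto simp: paired_def)
    finally have 1: "?X * ?Y \<le> M + e * (a + b + 6)" .
    have "M \<le> hi_val a n * hi_val b m" using nm(1) by (simp add: paired_def)
    also have "\<dots> \<le> (?X + e) * (?Y + e)" using dn nb X e by (intro mult_mono) auto
    also have "\<dots> = ?X * ?Y + e * (?X + ?Y + e)" by (simp add: algebra_simps)
    also have "\<dots> \<le> ?X * ?Y + e * (a + b + 6)"
      using X Y e by (intro add_mono mult_left_mono) (simp_all del: cf.simps)
    finally have 2: "M \<le> ?X * ?Y + e * (a + b + 6)" .
    show ?thesis using 1 2 by (simp add: abs_le_iff mult.commute)
  qed
  then show ?thesis using that nv mv len unfolding e_def by blast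
qed

text \<open>With \<open>a\<close> determined by \<open>sqrt M\<close>, the range of products for
  \<open>(a, a)\<close> overlaps that for \<open>(a, a + 1)\<close>, and the latter reaches the
  start \<open>(a + 158/125)^2\<close> of the range for \<open>(a + 1, a + 1)\<close>. The least
  case starts at \<open>(533/125)^2\<close>, below 92/5.\<close>

lemma center_digits_exist:
  fixes M :: real
  assumes "92/5 \<le> M"
  obtains a b where "4 \<le> a" "b = a \<or> b = Suc a"
    "(a + 33/125) * (b + 33/125) \<le> M" "M \<le> (a + 207/250) * (b + 207/250)"
proof -
  define z where "z = sqrt M"
  have z: "0 \<le> z" "z * z = M" using assms by (auto simp: z_def)
  have "533/125 \<le> z" unfolding z_def
    by (rule real_le_rsqrt) (use assms in \<open>simp add: power2_eq_square\<close>)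
  define a where "a = nat \<lfloor>z - 33/125\<rfloor>"
  have a: "4 \<le> a" "a + 33/125 \<le> z" "z < a + 158/125"
    using \<open>533/125 \<le> z\<close> unfolding a_def by linarith+
  have lo: "(a + 33/125) * (a + 33/125) \<le> M" unfolding z(2)[symmetric] using a
    by (intro mult_mono) auto
  have hi: "M \<le> (a + 158/125) * (a + 158/125)" unfolding z(2)[symmetric] using a z
    by (intro mult_mono) auto
  have a4: "4 \<le> real a" using a by simp
  show ?thesis
  proof (cases "M \<le> (a + 207/250) * (a + 207/250)")
    case True
    then show ?thesis using that[of a a] a lo by auto
  next
    case False
    have "(a + 33/125) * (Suc a + 33/125) \<le> (a + 207/250) * (a + 207/250)"
      using a4 by (simp add: algebra_simps)
    moreover have "(a + 158/125) * (a + 158/125) \<le> (a + 207/250) * (Suc a + 207/250)"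
      using a4 by (simp add: algebra_simps)
    ultimately show ?thesis using that[of a "Suc a"] a False hi by auto
  qed
qed

subsection \<open>Concatenation\<close>

locale word_blocks =
  fixes block :: "nat \<Rightarrow> nat list"
  assumes nonempty: "block n \<noteq> []"
begin

definition start :: "nat \<Rightarrow> nat" where "start n = (\<Sum>k<n. length (block k))"

definition seq :: "nat \<Rightarrow> nat" where
  "seq i = (let n = LEAST n. i < start (Suc n) in block n ! (i - start n))"

lemma start_Suc: "start (Suc n) = start n + length (block n)"
  by (simp add: start_def)

lemma start_mono: "m \<le> n \<Longrightarrow> start m \<le> start n"
  by (rule lift_Suc_mono_le[of start]) (auto simp: start_Suc)

lemma start_ge: "n \<le> start n"
proof (induction n)
  case (Suc n)
  have "0 < length (block n)" using nonempty by simp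
  then show ?case using Suc unfolding start_Suc by linarith
qed simp

lemma seq_at:
  assumes "i < length (block n)"
  shows "seq (start n + i) = block n ! i"
proof -
  have "(LEAST m. start n + i < start (Suc m)) = n"
  proof (rule Least_equality)
    show "start n + i < start (Suc n)" using assms by (simp add: start_Suc)
    fix m assume "start n + i < start (Suc m)"
    then show "n \<le> m" using start_mono[of "Suc m" n] by (cases "n \<le> m") auto
  qed
  then show ?thesis by (simp add: seq_def)
qed

lemma position:
  obtains n k where "i = start n + k" "k < length (block n)"
proof -
  define n where "n = (LEAST n. i < start (Suc n))"
  have "i < start (Suc i)" using start_ge[of "Suc i"] by simp
  then have 1: "i < start (Suc n)" unfolding n_def by (rule LeastI)
  have "start n \<le> i"
  proof (cases n)
    case (Suc m)
    then show ?thesis using not_less_Least[of m "\<lambda>n. i < start (Suc n)"]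
      by (simp add: n_def)
  qed (simp add: start_def)
  then show ?thesis using that[of n "i - start n"] 1 by (simp add: start_Suc)
qed

end

section \<open>Products away from the centre of a block\<close>

lemma legal_le4: "legal s w \<Longrightarrow> i < length w \<Longrightarrow> 1 \<le> w ! i \<and> w ! i \<le> 4"
proof (induction w arbitrary: s i)
  case (Cons d w)
  have "max_digit s \<le> 4" by (cases s) auto
  then show ?case using Cons by (cases i) auto
qed simp

text \<open>The indices 0 and 2 are the places at distances 1 and 3 from the preceding
  \<open>4\<close>.\<close>

lemma legal_After4:
  assumes "legal After4 w"
  shows "0 < length w \<Longrightarrow> w ! 0 \<le> 3" "2 < length w \<Longrightarrow> w ! 2 \<le> 3"
proof -
  show "w ! 0 \<le> 3" if "0 < length w" using assms that by (cases w) auto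
  show "w ! 2 \<le> 3" if len: "2 < length w"
  proof -
    obtain d1 d2 d3 r where "w = d1 # d2 # d3 # r"
      using len by (cases w; cases "tl w"; cases "tl (tl w)") auto
    then show ?thesis using assms by (cases "d2 = 4") (auto split: if_splits)
  qed
qed

lemma legal_distance_4:
  assumes "legal s w" "i < length w" "w ! i = 4"
  shows "Suc i < length w \<Longrightarrow> w ! Suc i \<le> 3" "i + 3 < length w \<Longrightarrow> w ! (i + 3) \<le> 3"
proof -
  have "(Suc i < length w \<longrightarrow> w ! Suc i \<le> 3) \<and> (i + 3 < length w \<longrightarrow> w ! (i + 3) \<le> 3)"
    using assms
  proof (induction w arbitrary: s i)
    case (Cons d w)
    show ?case
    proof (cases i)
      case 0
      then have "legal After4 w" using Cons.prems by simp
      from legal_After4[OF this] show ?thesis using 0 by (auto simp: numeral_3_eq_3 numeral_2_eq_2)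
    next
      case (Suc k)
      then show ?thesis using Cons.IH[of "next_phase s d" k] Cons.prems
        by (simp add: numeral_3_eq_3)
    qed
  qed simp
  then show "Suc i < length w \<Longrightarrow> w ! Suc i \<le> 3" "i + 3 < length w \<Longrightarrow> w ! (i + 3) \<le> 3" by auto
qed

text \<open>The factors \<open>4 3 1 4\<close> and \<open>4 1 3 4\<close> are excluded, so the value read from a
  digit \<open>3\<close> next to a \<open>4\<close> is at most \<open>19/5\<close>.\<close>

lemma three_side_le:
  fixes P Q R S :: real
  assumes "P = 3 + 1 / Q" "Q = real q + 1 / R" "1 \<le> q" "q = 1 \<Longrightarrow> R \<le> 4" "0 < R"
  shows "P \<le> 19/5"
proof (cases "q = 1")
  case True
  then have "1/4 \<le> 1/R" using assms by (intro divide_left_mono) auto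
  then have "5/4 \<le> Q" using assms True by simp
  then have "1 / Q \<le> 1 / (5/4)" by (intro divide_left_mono) auto
  then show ?thesis using assms by simp
next
  case False
  then have "2 \<le> real q" using assms by linarith
  then have "2 \<le> Q" using assms by (simp add: add_increasing2)
  then have "1 / Q \<le> 1 / 2" by (intro divide_left_mono) auto
  then show ?thesis using assms by simp
qed

text \<open>Here 6/5 is the least value of a digit at least 1 followed by a value at most 5.\<close>

lemma four_side_le:
  fixes P Q R :: real
  assumes "P = 4 + 1 / Q" "6/5 \<le> Q"
  shows "P \<le> 29/6"
proof -
  have "1 / Q \<le> 1 / (6/5)" using assms by (intro divide_left_mono) auto
  then show ?thesis using assms by simp
qed

text \<open>Stated for abstract \<open>inw\<close>, reading towards the centre, and
  \<open>outw\<close>, reading away from it, so that it serves both wings with \<open>bwd\<close>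
  and \<open>z\<close> exchanged. Index 0 is the centre digit, and the final \<open>2\<close> is the
  separating digit. The bound 1/4 in \<open>in0\<close> comes from the other centre digit, which is
  at least 4.\<close>

lemma wing_bound:
  fixes inw outw :: "nat \<Rightarrow> real"
  and w :: "nat list"
  assumes legal: "legal After4 u" and a: "4 \<le> a"
    and w: "w = a # u @ [2]"
    and inw: "\<And>k. k \<le> length u \<Longrightarrow> inw (Suc k) = w ! Suc k + 1 / inw k"
    and outw: "\<And>k. k \<le> length u \<Longrightarrow> outw k = w ! k + 1 / outw (Suc k)"
    and in0: "a \<le> inw 0" "inw 0 \<le> a + 1/4"
    and outL: "2 \<le> outw (Suc (length u))" "outw (Suc (length u)) \<le> 3"
    and M: "92/5 \<le> M" "533/125 * (a + 33/125) \<le> M"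
    and k: "k \<le> length u"
  shows "inw k * outw (Suc k) \<le> M"
proof -
  let ?L = "length u"
  have leg: "legal After4 (u @ [2])"
  proof -
    have "2 \<le> max_digit s" for s by (rule two_le_max_digit)
    then show ?thesis using legal by (simp add: legal_append)
  qed
  have wS: "w ! Suc i = (u @ [2]) ! i" for i by (simp add: w)
  have wL: "w ! Suc ?L = 2" by (simp add: w)
  have dig: "1 \<le> w ! Suc i \<and> w ! Suc i \<le> 4" if "i \<le> ?L" for i
    using legal_le4[OF leg, of i] that by (simp add: wS)
  have w0: "w ! 0 = a" by (simp add: w)
  have w1: "w ! 1 \<le> 3" using leg by (cases u) (auto simp: w)
  have dig': "1 \<le> w ! i" if "i \<le> Suc ?L" for i using dig[of "i - 1"] that a w0
    by (cases i) auto
  have ob: "w ! i \<le> outw i \<and> outw i \<le> real (w ! i) + 1" if "i \<le> Suc ?L" for i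
    using that
  proof (induction "Suc ?L - i" arbitrary: i)
    case 0
    then have "i = Suc ?L" by simp
    then show ?case using outL wL by simp
  next
    case (Suc n)
    then have "n = Suc ?L - Suc i" "Suc i \<le> Suc ?L" by auto
    from Suc.hyps(1)[OF this] have "1 \<le> outw (Suc i)"
      using dig'[of "Suc i"] \<open>Suc i \<le> Suc ?L\<close> by linarith
    then have "0 \<le> 1 / outw (Suc i)" "1 / outw (Suc i) \<le> 1" by auto
    then show ?case using outw[of i] \<open>Suc i \<le> Suc ?L\<close> by simp
  qed
  have ib: "w ! i \<le> inw i \<and> inw i \<le> real (w ! i) + 1" if "i \<le> Suc ?L" for i
    using that
  proof (induction i)
    case 0
    then show ?case using in0 w0 by simp
  next
    case (Suc i)
    then have "1 \<le> inw i" using dig'[of i] by linarith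
    then have "0 \<le> 1 / inw i" "1 / inw i \<le> 1" by auto
    then show ?case using inw[of i] Suc.prems by simp
  qed
  have o1: "1 \<le> outw i" "1 \<le> inw i" if "i \<le> Suc ?L" for i
    using ob[OF that] ib[OF that] dig'[OF that] by linarith+
  have crude: "inw k * outw (Suc k) \<le> X * Y" if "inw k \<le> X" "outw (Suc k) \<le> Y" for X Y
    using that o1[of k] o1[of "Suc k"] k by (intro mult_mono) auto
  show ?thesis
  proof (cases k)
    case 0
    \<comment> \<open>The digit next to the centre is at most 3, and \<open>4 * a + 1\<close> is
      below \<open>533/125 * (a + 33/125)\<close>.\<close>
    have "outw (Suc k) \<le> 4" using ob[of 1] w1 0 by simp
    then have "inw k * outw (Suc k) \<le> (a + 1/4) * 4" using in0 0 by (intro crude) auto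
    also have "\<dots> \<le> M" using M a by simp
    finally show ?thesis .
  next
    case (Suc i)
    have i: "Suc i \<le> ?L" using k Suc by simp
    have d: "w ! k \<le> 4" "w ! Suc k \<le> 4" using dig[of i] dig[of k] k Suc by auto
    have not44: "\<not> (w ! k = 4 \<and> w ! Suc k = 4)"
      using legal_distance_4(1)[OF leg, of i] i by (auto simp: Suc wS)
    have in_le: "inw k \<le> real (w ! k) + 1" and out_le: "outw (Suc k) \<le> real (w ! Suc k) + 1"
      using ib[of k] ob[of "Suc k"] k by auto
    show ?thesis
    proof (cases "a = 4")
      case False
      then have M20: "20 \<le> M" using M(2) a by simp
      consider "w ! k \<le> 3" | "w ! Suc k \<le> 3" using d not44 by linarith
      then have "inw k * outw (Suc k) \<le> 20"
      proof cases
        case 1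
        then show ?thesis using crude[of 4 5] in_le out_le d by simp
      next
        case 2
        then show ?thesis using crude[of 5 4] in_le out_le d by simp
      qed
      then show ?thesis using M20 by simp
    next
      case a4: True
      have dig4: "w ! j \<le> 4" if "j \<le> Suc ?L" for j using dig[of "j - 1"] that a4 w0
        by (cases j) auto
      \<comment> \<open>For \<open>a = 4\<close> the rule on distance 3 extends to the centre digit
        at index 0, because \<open>u\<close> starts in phase \<open>After4\<close>.\<close>
      have dist3: "w ! (j + 3) \<le> 3" if "w ! j = 4" "j + 3 \<le> Suc ?L" for j
      proof (cases j)
        case 0
        then show ?thesis using legal_After4(2)[OF leg] that
          by (simp add: wS numeral_3_eq_3 numeral_2_eq_2)
      next
        case (Suc j')
        then show ?thesis using that legal_distance_4(2)[OF leg, of j'] wS[of j'] wS[of "j' + 3"]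
          by simp
      qed
      consider "w ! k = 3" "w ! Suc k = 4" | "w ! k = 4" "w ! Suc k = 3" | "w ! k \<le> 3"
          "w ! Suc k \<le> 3"
        | "w ! k \<le> 2" | "w ! Suc k \<le> 2"
        using d not44 by linarith
      then show ?thesis
      proof cases
        case 1
        have "Suc k \<noteq> Suc ?L" using 1 wL by auto
        then have kL: "Suc k \<le> ?L" using k by simp
        have "inw k \<le> 19/5"
        proof (cases i)
          case 0
          then have "inw k = 3 + 1 / inw 0" using inw[of 0] 1 Suc by simp
          moreover have "1 / inw 0 \<le> 1/4" using in0 a4 by (simp add: field_simps)
          ultimately show ?thesis by simp
        next
          case (Suc j)
          have "inw k = 3 + 1 / inw i" using inw[of i] i 1 \<open>k = Suc i\<close> by simp
          moreover have "inw i = real (w ! i) + 1 / inw j" using inw[of j] i Suc by simp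
          \<comment> \<open>A \<open>4\<close> at \<open>j\<close> would have distance 3 from the
            \<open>4\<close> at \<open>Suc k\<close>. This excludes 4 1 3 4, the only pattern with a
            larger value.\<close>
          moreover have "inw j \<le> 4"
          proof -
            have "w ! j \<noteq> 4" using dist3[of j] 1 kL
              by (auto simp: Suc \<open>k = Suc i\<close> numeral_3_eq_3)
            then have "w ! j \<le> 3" using dig4[of j] i Suc by simp
            then show ?thesis using ib[of j] i Suc by simp
          qed
          moreover have "1 \<le> w ! i" "0 < inw j" using dig'[of i] o1[of j] i Suc by auto
          ultimately show ?thesis by (intro three_side_le[of _ "inw i" "w ! i" "inw j"])
        qed
        moreover have "outw (Suc k) \<le> 29/6"
        proof (rule four_side_le)
          show "outw (Suc k) = 4 + 1 / outw (Suc (Suc k))" using outw[of "Suc k"] kL 1 by simp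
          show "6/5 \<le> outw (Suc (Suc k))"
          proof (cases "Suc k = ?L")
            case True
            then show ?thesis using outL by simp
          next
            case False
            then have l: "Suc (Suc k) \<le> ?L" using kL by simp
            have "outw (Suc (Suc (Suc k))) \<le> 5"
              using ob[of "Suc (Suc (Suc k))"] dig4[of "Suc (Suc (Suc k))"] l by simp
            then have "1/5 \<le> 1 / outw (Suc (Suc (Suc k)))" using o1[of "Suc (Suc (Suc k))"] l
              by (intro divide_left_mono) auto
            then show ?thesis using outw[OF l] dig'[of "Suc (Suc k)"] l by simp
          qed
        qed
        ultimately have "inw k * outw (Suc k) \<le> 19/5 * (29/6)" by (rule crude)
        then show ?thesis using M by simp
      next
        case 2
        have kL: "Suc k \<le> ?L" using 2 wL k by (cases "k = ?L") auto
        have i0: "i \<noteq> 0" using 2(1) w1 unfolding Suc by (cases i) auto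
        then obtain j where j: "i = Suc j" by (cases i) auto
        have "inw k \<le> 29/6"
        proof (rule four_side_le)
          show "inw k = 4 + 1 / inw i" using inw[of i] i 2 Suc by simp
          have "inw j \<le> 5" using ib[of j] dig4[of j] i j by simp
          then have "1/5 \<le> 1 / inw j" using o1[of j] i j by (intro divide_left_mono) auto
          then show "6/5 \<le> inw i" using inw[of j] dig'[of i] i j by simp
        qed
        moreover have "outw (Suc k) \<le> 19/5"
        proof (cases "Suc k = ?L")
          case True
          then have "outw (Suc k) = 3 + 1 / outw (Suc ?L)" using outw[of ?L] 2 by simp
          moreover have "1 / outw (Suc ?L) \<le> 1/2" using outL by (simp add: field_simps)
          ultimately show ?thesis by simp
        next
          case False
          then have l: "Suc (Suc k) \<le> ?L" using kL by simp
          show ?thesis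
          proof (rule three_side_le)
            show "outw (Suc k) = 3 + 1 / outw (Suc (Suc k))" using outw[OF kL] 2 by simp
            show "outw (Suc (Suc k)) = real (w ! Suc (Suc k)) + 1 / outw (Suc (Suc (Suc k)))"
              by (rule outw[OF l])
            show "1 \<le> w ! Suc (Suc k)" using dig'[of "Suc (Suc k)"] l by simp
            show "0 < outw (Suc (Suc (Suc k)))" using o1[of "Suc (Suc (Suc k))"] l by linarith
            have "w ! Suc (Suc (Suc k)) \<le> 3" using dist3[of k] 2 l by (simp add: numeral_3_eq_3)
            then show "outw (Suc (Suc (Suc k))) \<le> 4" using ob[of "Suc (Suc (Suc k))"] l by simp
          qed
        qed
        ultimately have "inw k * outw (Suc k) \<le> 29/6 * (19/5)" by (rule crude)
        then show ?thesis using M by simp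
      next
        case 3
        then show ?thesis using crude[of 4 4] in_le out_le M by simp
      next
        case 4
        then show ?thesis using crude[of 3 5] in_le out_le d M by simp
      next
        case 5
        then show ?thesis using crude[of 5 3] in_le out_le d M by simp
      qed
    qed
  qed
qed


text \<open>Block \<open>n\<close> has a centre whose product is within \<open>e n\<close> of
  \<open>M\<close>, whatever surrounds the block, while all other products are at most
  \<open>M\<close>. As \<open>e n\<close> tends to 0, the upper limit is exactly
  \<open>M\<close>.\<close>

lemma spectrum_value:
  fixes M :: real
  assumes M: "92/5 \<le> M"
  shows "\<exists>x. dirichlet_const x = ereal (M / (M + 1))"
proof -
  obtain a b where ab: "4 \<le> a" "b = a \<or> b = Suc a"
    and aM: "(a + 33/125) * (b + 33/125) \<le> M" "M \<le> (a + 207/250) * (b + 207/250)"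
    using center_digits_exist[OF M] by metis
  have b4: "4 \<le> b" using ab by auto
  define e where "e n = (real a + real b + 6) * (4 * (1/2) ^ Suc n)" for n :: nat
  have "\<exists>u v. legal After4 u \<and> legal After4 v \<and> Suc n \<le> length u \<and> Suc n \<le> length v \<and>
      (\<forall>s t. 1 \<le> s \<longrightarrow> 1 \<le> t \<longrightarrow> \<bar>cf (a # u) s * cf (b # v) t - M\<bar> \<le> e n)" for n
    using product_words[OF ab aM, of "Suc n"] unfolding e_def by metis
  then obtain u v where u: "\<And>n. legal After4 (u n)" and v: "\<And>n. legal After4 (v n)"
    and near: "\<And>n s t. 1 \<le> s \<Longrightarrow> 1 \<le> t \<Longrightarrow> \<bar>cf (a # u n) s * cf (b # v n) t - M\<bar> \<le> e n"
    by metis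
  define block where "block n = 2 # rev (v n) @ [b, a] @ u n" for n
  interpret word_blocks block by unfold_locales (simp add: block_def)
  have dig: "\<forall>d\<in>set (block n). 1 \<le> d" for n
    using legal_ge1[OF u[of n]] legal_ge1[OF v[of n]] ab by (auto simp: block_def)
  have head: "block n ! 0 = 2" for n by (simp add: block_def)
  have seq1: "1 \<le> seq i" for i
  proof -
    obtain n k where "i = start n + k" "k < length (block n)" by (rule position)
    then show ?thesis using seq_at[of k n] dig[of n] by auto
  qed
  obtain z where z: "\<And>n. z n = real (seq n) + 1 / z (Suc n)" "\<And>n. 1 < z n"
    using complete_quotients_exist[of seq] seq1 by metis
  interpret continued_fraction seq z by unfold_locales (rule seq1 z)+
  \<comment> \<open>The place of the centre digit \<open>b\<close> in block \<open>n\<close>;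
    \<open>bwd (q n)\<close> reads \<open>b\<close> and \<open>v n\<close> leftwards, and
    \<open>z (Suc (q n))\<close> reads \<open>a\<close> and \<open>u n\<close> rightwards.\<close>
  define q where "q n = start n + Suc (length (v n))" for n
  have len: "length (block n) = length (u n) + length (v n) + 3" for n by (simp add: block_def)
  have q_end: "q n + Suc (Suc (length (u n))) = start (Suc n)" for n
    by (simp add: q_def start_Suc len)
  \<comment> \<open>The last \<open>2\<close> belongs to the next block; on the left, the
    \<open>2\<close> is the head of the block itself.\<close>
  have right: "seq (q n + Suc k) = (a # u n @ [2]) ! k" if "k \<le> Suc (length (u n))" for n k
  proof (cases "k = Suc (length (u n))")
    case True
    then have "q n + Suc k = start (Suc n) + 0" using q_end[of n] by simp
    also have "seq (start (Suc n) + 0) = block (Suc n) ! 0" using len by (intro seq_at) simp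
    finally show ?thesis using True by (simp add: head nth_append)
  next
    case False
    then have k: "k \<le> length (u n)" using that by simp
    have "seq (start n + (length (v n) + 2 + k)) = block n ! (length (v n) + 2 + k)"
      using k len by (intro seq_at) simp
    also have "\<dots> = (a # u n @ [2]) ! k" using k
      by (cases k) (auto simp: block_def nth_append)
    finally show ?thesis by (simp add: q_def add.assoc)
  qed
  have left: "seq (q n - k) = (b # v n @ [2]) ! k" if "k \<le> Suc (length (v n))" for n k
  proof -
    have "seq (start n + (Suc (length (v n)) - k)) = block n ! (Suc (length (v n)) - k)"
      using len by (intro seq_at) simp
    also have "\<dots> = (b # v n @ [2]) ! k"
    proof -
      have "k = 0 \<or> k = Suc (length (v n)) \<or> k < Suc (length (v n))" using that by linarith
      then consider "k = 0" | j where "k = Suc j" "j < length (v n)" | "k = Suc (length (v n))"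
        by (metis not0_implies_Suc Suc_less_eq)
      then show ?thesis
      proof cases
        case 2
        then obtain m where m: "length (v n) - j = Suc m" by (cases "length (v n) - j") auto
        then have "m < length (v n)" "length (v n) - Suc m = j" using 2 by auto
        then show ?thesis using 2 m by (simp add: block_def nth_append rev_nth)
      qed (auto simp: block_def nth_append)
    qed
    finally show ?thesis using that by (simp add: q_def)
  qed
  have mid: "\<bar>bwd (q n) * z (Suc (q n)) - M\<bar> \<le> e n" for n
  proof -
    have "map seq [Suc (q n)..<Suc (q n) + Suc (length (u n))] = a # u n"
      by (rule nth_equalityI) (use right[of _ n]
          in \<open>auto simp: nth_append nth_Cons' simp del: upt_Suc\<close>)
    then have "z (Suc (q n)) = cf (a # u n) (z (Suc (q n) + Suc (length (u n))))"
      using z_cf by metis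
    moreover have "rev (map seq [Suc (start n)..<Suc (start n + Suc (length (v n)))]) = b # v n"
    proof (rule nth_equalityI)
      fix i assume i: "i < length (rev (map seq [Suc (start n)..<Suc (start n + Suc (length (v n)))]))"
      then have i': "i \<le> length (v n)" by (simp del: upt_Suc)
      have "rev (map seq [Suc (start n)..<Suc (start n + Suc (length (v n)))]) ! i = seq (q n - i)"
        using i' by (simp add: rev_nth q_def Suc_diff_le del: upt_Suc)
      then show "rev (map seq [Suc (start n)..<Suc (start n + Suc (length (v n)))]) ! i = (b # v n) ! i"
        using left[of i n] i' by (auto simp: nth_append nth_Cons' split: if_splits)
    qed (simp del: upt_Suc)
    then have "bwd (q n) = cf (b # v n) (bwd (start n))"
      unfolding q_def by (metis bwd_cf)
    ultimately show ?thesis using near[of "z (Suc (q n) + Suc (length (u n)))"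
        "bwd (start n)" n] bwd_ge1 z_gt1
      by (simp add: mult.commute less_imp_le del: cf.simps)
  qed
  \<comment> \<open>Either centre digit is at least 4, so its factor is at least
    \<open>533/125 = 4 + 33/125\<close>.\<close>
  have lower: "533/125 * (a + 33/125) \<le> M" "533/125 * (b + 33/125) \<le> M"
  proof -
    have "533/125 * (a + 33/125) \<le> (b + 33/125) * (a + 33/125)" using b4
      by (intro mult_right_mono) auto
    then show "533/125 * (a + 33/125) \<le> M" using aM by (simp add: mult.commute)
    have "533/125 * (b + 33/125) \<le> (a + 33/125) * (b + 33/125)" using ab
      by (intro mult_right_mono) auto
    then show "533/125 * (b + 33/125) \<le> M" using aM by simp
  qed
  have seq_start: "seq (start n) = 2" for n using seq_at[of 0 n] by (simp add: len head)
  have off_right: "bwd (q n + Suc k) * z (Suc (q n + Suc k)) \<le> M"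
    if k: "k \<le> length (u n)" for n k
  proof -
    define inw where "inw i = bwd (q n + Suc i)" for i
    define outw where "outw i = z (q n + Suc i)" for i
    have "inw k * outw (Suc k) \<le> M"
    proof (rule wing_bound[OF u ab(1) refl])
      show "inw (Suc i) = (a # u n @ [2]) ! Suc i + 1 / inw i" if "i \<le> length (u n)" for i
        using right[of "Suc i" n] that by (simp add: inw_def)
      show "outw i = (a # u n @ [2]) ! i + 1 / outw (Suc i)" if "i \<le> length (u n)" for i
        using right[of i n] that z_rec[of "q n + Suc i"] by (simp add: outw_def)
      have "inw 0 = a + 1 / bwd (q n)" using right[of 0 n] by (simp add: inw_def)
      moreover have "4 \<le> bwd (q n)" using bwd_bounds(1)[of "q n"] left[of 0 n] b4 by simp
      moreover have "0 \<le> 1 / bwd (q n)" using bwd_ge1[of "q n"] by simp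
      moreover have "1 / bwd (q n) \<le> 1/4" using \<open>4 \<le> bwd (q n)\<close>
        by (intro divide_left_mono) auto
      ultimately show "a \<le> inw 0" "inw 0 \<le> a + 1/4" by auto
      have "outw (Suc (length (u n))) = z (start (Suc n))" using q_end[of n] by (simp add: outw_def)
      then show "2 \<le> outw (Suc (length (u n)))" "outw (Suc (length (u n))) \<le> 3"
        using z_bounds[of "start (Suc n)"] seq_start[of "Suc n"] by auto
    qed (use M lower k in auto)
    then show ?thesis by (simp add: inw_def outw_def)
  qed
  have off_left: "bwd (q n - Suc k) * z (q n - k) \<le> M" if k: "k \<le> length (v n)" for n k
  proof -
    define inw where "inw i = z (q n - i)" for i
    define outw where "outw i = bwd (q n - i)" for i
    have "inw k * outw (Suc k) \<le> M"
    proof (rule wing_bound[OF v b4 refl])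
      have step: "q n - i = Suc (q n - Suc i)" if "i \<le> length (v n)" for i
        using that by (simp add: q_def)
      show "inw (Suc i) = (b # v n @ [2]) ! Suc i + 1 / inw i" if "i \<le> length (v n)" for i
        using left[of "Suc i" n] that z_rec[of "q n - Suc i"] step[OF that] by (simp add: inw_def)
      show "outw i = (b # v n @ [2]) ! i + 1 / outw (Suc i)" if "i \<le> length (v n)" for i
        using left[of i n] that step[OF that] by (simp add: outw_def)
      have "inw 0 = b + 1 / z (Suc (q n))" using left[of 0 n] z_rec[of "q n"] by (simp add: inw_def)
      moreover have "4 \<le> z (Suc (q n))" using z_bounds(1)[of "Suc (q n)"] right[of 0 n] ab
        by simp
      moreover have "0 \<le> 1 / z (Suc (q n))" using z_gt1[of "Suc (q n)"] by simp
      moreover have "1 / z (Suc (q n)) \<le> 1/4" using \<open>4 \<le> z (Suc (q n))\<close>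
        by (intro divide_left_mono) auto
      ultimately show "b \<le> inw 0" "inw 0 \<le> b + 1/4" by auto
      have "outw (Suc (length (v n))) = bwd (start n)" by (simp add: outw_def q_def)
      then show "2 \<le> outw (Suc (length (v n)))" "outw (Suc (length (v n))) \<le> 3"
        using bwd_bounds[of "start n"] seq_start[of n] by auto
    qed (use M lower k in auto)
    then show ?thesis by (simp add: inw_def outw_def mult.commute)
  qed
  have cases: "bwd i * z (Suc i) \<le> M \<or> (\<exists>n. i = q n)" for i
  proof -
    obtain n k where nk: "i = start n + k" "k < length (block n)" by (rule position)
    consider "k \<le> length (v n)" | "k = Suc (length (v n))" | "Suc (length (v n)) < k"
      by linarith
    then show ?thesis
    proof cases
      case 1
      define j where "j = length (v n) - k"
      have "i = q n - Suc j" "Suc i = q n - j" "j \<le> length (v n)" using 1 nk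
        by (auto simp: j_def q_def)
      then show ?thesis using off_left[of j n] by simp
    next
      case 2
      then show ?thesis using nk by (auto simp: q_def)
    next
      case 3
      define j where "j = k - (length (v n) + 2)"
      have "i = q n + Suc j" "j \<le> length (u n)" using 3 nk len[of n] by (auto simp: j_def q_def)
      then show ?thesis using off_right[of j n] by simp
    qed
  qed
  have e0: "e \<longlonglongrightarrow> 0" unfolding e_def by real_asymp
  have q_ge: "n \<le> q n" for n using start_ge[of n] by (simp add: q_def)
  have "dirichlet_const alpha = ereal (M / (M + 1))"
  proof (rule dirichlet_const_products)
    show "0 < M" using M by simp
  next
    fix B assume "M < B"
    then have "\<forall>\<^sub>F n in sequentially. e n < B - M"
      by (intro order_tendstoD(2)[OF e0]) simp
    then obtain N where N: "\<And>n. N \<le> n \<Longrightarrow> e n < B - M"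
      by (auto simp: eventually_sequentially)
    have "bwd i * z (Suc i) < B" if i: "q N \<le> i" for i
    proof (cases "\<exists>n. i = q n")
      case True
      then obtain n where n: "i = q n" by blast
      have "N \<le> n"
      proof (rule ccontr)
        assume "\<not> N \<le> n"
        then have "start (Suc n) \<le> start N" by (intro start_mono) simp
        then show False using q_end[of n] i n by (simp add: q_def)
      qed
      then show ?thesis unfolding n using mid[of n] N[of n] by linarith
    next
      case False
      then show ?thesis using cases[of i] \<open>M < B\<close> by auto
    qed
    then show "\<forall>\<^sub>F i in sequentially. bwd i * z (Suc i) < B"
      by (auto simp: eventually_sequentially)
  next
    fix B assume "B < M"
    then have "\<forall>\<^sub>F n in sequentially. e n < M - B"
      by (intro order_tendstoD(2)[OF e0]) simp
    then obtain N where N: "\<And>n. N \<le> n \<Longrightarrow> e n < M - B"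
      by (auto simp: eventually_sequentially)
    have "B < bwd (q n) * z (Suc (q n))" if "N \<le> n" for n using mid[of n] N[OF that] by linarith
    then have "\<exists>i\<ge>m. B < bwd i * z (Suc i)" for m
      using q_ge[of "max m N"] by (intro exI[of _ "q (max m N)"]) auto
    then show "\<exists>\<^sub>F i in sequentially. B < bwd i * z (Suc i)"
      by (simp add: frequently_sequentially)
  qed
  then show ?thesis by blast
qed

text \<open>The value 1 is not of the form \<open>M / (M + 1)\<close>; it is obtained from unbounded
  digits, for which the products tend to infinity.\<close>

lemma spectrum_one: "\<exists>x. dirichlet_const x = ereal 1"
proof -
  have s: "1 \<le> Suc n" for n by simp
  obtain z where z: "\<And>n. z n = real (Suc n) + 1 / z (Suc n)" "\<And>n. 1 < z n"
    using complete_quotients_exist[of Suc, OF s] by blast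
  interpret continued_fraction Suc z by unfold_locales (rule s z)+
  have ge: "Suc n \<le> bwd n * z (Suc n)" for n
  proof -
    have "real (Suc n) * 1 \<le> bwd n * z (Suc n)"
      using bwd_bounds(1)[of n] z_gt1[of "Suc n"] by (intro mult_mono) auto
    then show ?thesis by simp
  qed
  have pos: "0 < bwd n * z (Suc n)" for n using ge[of n] by linarith
  have "dirichlet_const alpha = ereal 1"
  proof (rule dirichlet_const_eq)
    fix y :: real
    show "\<forall>\<^sub>F n in sequentially. 1 / (1 + 1 / (bwd n * z (Suc n))) < y" if "1 < y"
    proof (intro always_eventually allI)
      fix n
      have "0 < 1 / (bwd n * z (Suc n))" using pos by simp
      then have "1 / (1 + 1 / (bwd n * z (Suc n))) < 1"
        using divide_less_eq_1_pos[of "1 + 1 / (bwd n * z (Suc n))" 1] by linarith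
      then show "1 / (1 + 1 / (bwd n * z (Suc n))) < y" using that by linarith
    qed
    show "\<exists>\<^sub>F n in sequentially. y < 1 / (1 + 1 / (bwd n * z (Suc n)))" if "y < 1"
    proof -
      have "(\<lambda>n. 1 / (1 + 1 / real (Suc n))) \<longlonglongrightarrow> 1" by real_asymp
      then have "\<forall>\<^sub>F n in sequentially. y < 1 / (1 + 1 / real (Suc n))" using that
        by (rule order_tendstoD)
      then have "\<forall>\<^sub>F n in sequentially. y < 1 / (1 + 1 / (bwd n * z (Suc n)))"
      proof eventually_elim
        case (elim n)
        have "1 / (bwd n * z (Suc n)) \<le> 1 / real (Suc n)" using ge[of n]
          by (intro divide_left_mono) (use pos in auto)
        moreover have "0 < 1 / (bwd n * z (Suc n))" using pos by simp
        ultimately have "1 / (1 + 1 / real (Suc n)) \<le> 1 / (1 + 1 / (bwd n * z (Suc n)))"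
          by (intro frac_le) linarith+
        then show ?case using elim by linarith
      qed
      then show ?thesis by (intro eventually_frequently) auto
    qed
  qed
  then show ?thesis by blast
qed

theorem corollary1p4:
  shows "dirichlet_ray_start \<le> 111 * (397 + sqrt 26565) / 65522"
proof -
  have "d \<in> dirichlet_spectrum" if d: "92/97 < d" "d \<le> 1" for d :: real
  proof (cases "d = 1")
    case True
    then show ?thesis using spectrum_one by (simp add: dirichlet_spectrum_def)
  next
    case False
    then have d1: "d < 1" using d by simp
    \<comment> \<open>The inverse of \<open>M / (M + 1)\<close>; the value 92/5 of \<open>M\<close>
      corresponds to \<open>d = 92/97\<close>.\<close>
    define M where "M = d / (1 - d)"
    have "92/5 \<le> M" using d d1 by (simp add: M_def field_simps)
    moreover have "M / (M + 1) = d" using d1 by (simp add: M_def field_simps)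
    ultimately show ?thesis using spectrum_value[of M] by (simp add: dirichlet_spectrum_def)
  qed
  then have "{92/97<..1} \<subseteq> dirichlet_spectrum" by auto
  then have "dirichlet_ray_start \<le> 92/97"
    unfolding dirichlet_ray_start_def using ray_set_bdd_below by (intro cInf_lower) auto
  also have "92/97 \<le> 111 * (397 + sqrt 26565) / 65522"
  proof -
    \<comment> \<open>This rational lower bound for the root already makes the right-hand side
      exceed 92/97.\<close>
    have "162.9 \<le> sqrt (26565::real)" by (rule real_le_rsqrt) (simp add: power2_eq_square)
    then show ?thesis by simp
  qed
  finally show ?thesis .
qed

end
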